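(* Let $R$ be a finite-dimensional regular quantum commutative algebra with regular quantum commutative decomposition $\mathscr{R}$ of quantum length $m$. Suppose that $\operatorname{char}(K)=0$ and that $\mathscr{R}$ is minimal. Then $m=\exp(R)$.
   Context: $K$ is an algebraically closed field of characteristic different from $2$; all algebras are unital associative $K$-algebras. A regular quantum commutative decomposition of an algebra $R$, of quantum length $m$, is a vector space decomposition $\mathscr{R}\colon R=R_1\oplus\cdots\oplus R_m$ such that, with $S=\{1,\dots,m\}$: (a) for every $n\in\mathbb{N}$ and every $(i_1,\dots,i_n)\in S^n$ there exist $a_j\in R_{i_j}$, $1\le j\le n$, with $a_1\cdots a_n\neq 0$; (b) there is a function $\theta\colon S\times S\to K^*$ such that $ab=\theta(i,j)ba$ for all $i,j\in S$, $a\in R_i$, $b\in R_j$. An algebra with a fixed such decomposition and $\theta$ is called a regular quantum commutative algebra. Its decomposition matrix is $M^R=(\theta(i,j))_{1\le i,j\le m}$, and $\mathscr{R}$ is minimal if no two columns (equivalently, rows) of $M^R$ with different indices are equal. The PI-exponent: let $P_n$ be the span of the monomials $x_{\sigma(1)}\cdots x_{\sigma(n)}$, $\sigma\in S_n$, in the free associative algebra $K\langle x_1,x_2,\dots\rangle$, let $T(R)$ be the ideal of polynomial identities of $R$, and $c_n(R)=\dim\big(P_n/(P_n\cap T(R))\big)$. Then $\exp(R)=\lim_{n\to\infty}\sqrt[n]{c_n(R)}$ (this limit exists and is an integer in characteristic $0$ by a theorem of Giambruno and Zaicev). *)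

theory Defs
  imports
    Complex_Main
    "HOL-Library.Poly_Mapping"
    "HOL-Library.FuncSet"
    "HOL-Combinatorics.Permutations"
    "HOL-Computational_Algebra.Polynomial"
begin

section \<open>The free associative algebra\<close>

text \<open>
  Concatenation of words is written additively because the convolution product on
  \<open>\<Rightarrow>\<^sub>0\<close> makes \<open>'w \<Rightarrow>\<^sub>0 'k\<close> the monoid algebra of an additively written
  (not necessarily commutative) monoid \<open>'w\<close>.
\<close>

datatype 'a word = Word (letters: "'a list")

instantiation word :: (type) monoid_add
begin

definition zero_word :: "'a word" where
  "0 = Word []"

definition plus_word :: "'a word \<Rightarrow> 'a word \<Rightarrow> 'a word" where
  "u + v = Word (letters u @ letters v)"

instance
  by standard (simp_all add: zero_word_def plus_word_def)

end

text \<open>The generator number \<open>i\<close> plays the role of the variable $x_{i+1}$.\<close>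

type_synonym 'k free_algebra = "nat word \<Rightarrow>\<^sub>0 'k"

definition fa_scale :: "'k::field \<Rightarrow> 'k free_algebra \<Rightarrow> 'k free_algebra" where
  "fa_scale c f = Poly_Mapping.map ((*) c) f"

lemma lookup_fa_scale [simp]:
  "Poly_Mapping.lookup (fa_scale c f) w = c * Poly_Mapping.lookup f w"
  by (simp add: fa_scale_def Poly_Mapping.map.rep_eq when_def)

global_interpretation free_algebra: vector_space fa_scale
  by standard
    (auto intro!: poly_mapping_eqI simp: lookup_add algebra_simps)

definition fa_monomial :: "nat list \<Rightarrow> 'k::field free_algebra" where
  "fa_monomial xs = Poly_Mapping.single (Word xs) 1"

text \<open>The space $P_n$ of multilinear polynomials in $x_1, \dots, x_n$.\<close>

definition multilinear_space :: "nat \<Rightarrow> 'k::field free_algebra set" where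
  "multilinear_space n =
     free_algebra.span {fa_monomial (map \<sigma> [0..<n]) | \<sigma>. \<sigma> permutes {..<n}}"


section \<open>Quotients of vector spaces\<close>

text \<open>The classes of the elements of \<open>B\<close> are pairwise distinct and form a basis of \<open>U / W\<close>.\<close>

definition quotient_basis ::
    "('k::field \<Rightarrow> 'v::ab_group_add \<Rightarrow> 'v) \<Rightarrow> 'v set \<Rightarrow> 'v set \<Rightarrow> 'v set \<Rightarrow> bool" where
  "quotient_basis scale U W B \<longleftrightarrow>
     B \<subseteq> U \<and>
     (\<forall>F c. finite F \<and> F \<subseteq> B \<and> (\<Sum>b\<in>F. scale (c b) b) \<in> W \<longrightarrow> (\<forall>b\<in>F. c b = 0)) \<and>
     (\<forall>u\<in>U. \<exists>v\<in>module.span scale B. u - v \<in> W)"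

definition quotient_dim ::
    "('k::field \<Rightarrow> 'v::ab_group_add \<Rightarrow> 'v) \<Rightarrow> 'v set \<Rightarrow> 'v set \<Rightarrow> nat" where
  "quotient_dim scale U W = card (SOME B. quotient_basis scale U W B)"

lemma (in vector_space) quotient_basis_exists:
  assumes "subspace U" "subspace W" "W \<subseteq> U"
  shows "\<exists>B. quotient_basis scale U W B"
proof -
  obtain C where C: "C \<subseteq> W" "independent C" "W \<subseteq> span C"
    using maximal_independent_subset by blast
  have CW: "span C = W"
    using C assms(2) by (simp add: span_minimal subset_antisym)
  have CU: "C \<subseteq> U"
    using C(1) assms(3) by blast
  obtain D where D: "C \<subseteq> D" "D \<subseteq> U" "independent D" "U \<subseteq> span D"
    using maximal_independent_subset_extend[OF CU C(2)] by blast
  define B where "B = D - C"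
  have indep: "c b = 0"
    if F: "finite F" "F \<subseteq> B" "(\<Sum>b\<in>F. c b *s b) \<in> W" and b: "b \<in> F" for F c b
  proof (rule ccontr)
    assume nz: "c b \<noteq> 0"
    have "C \<subseteq> D - {b}"
      using F(2) b D(1) B_def by blast
    then have 1: "(\<Sum>b\<in>F. c b *s b) \<in> span (D - {b})"
      using F(3) CW span_mono by blast
    have 2: "(\<Sum>b\<in>F - {b}. c b *s b) \<in> span (D - {b})"
      using F(2) B_def by (intro span_sum span_scale span_base) blast
    have "(\<Sum>b\<in>F. c b *s b) = c b *s b + (\<Sum>b\<in>F - {b}. c b *s b)"
      by (rule sum.remove[OF F(1) b])
    then have "c b *s b = (\<Sum>b\<in>F. c b *s b) - (\<Sum>b\<in>F - {b}. c b *s b)"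
      by simp
    then have "c b *s b \<in> span (D - {b})"
      using span_diff[OF 1 2] by simp
    then have "inverse (c b) *s (c b *s b) \<in> span (D - {b})"
      by (rule span_scale)
    then have "b \<in> span (D - {b})"
      using nz by simp
    moreover have "b \<in> D"
      using F(2) b B_def by blast
    ultimately show False
      using D(3) unfolding dependent_def by blast
  qed
  have "\<exists>v\<in>span B. u - v \<in> W" if "u \<in> U" for u
  proof -
    have "C \<union> B = D"
      using D(1) B_def by blast
    then have "u \<in> span (C \<union> B)"
      using that D(4) by auto
    then obtain x y where "u = x + y" "x \<in> span C" "y \<in> span B"
      unfolding span_Un by blast
    then show ?thesis
      using CW by auto
  qed
  moreover have "B \<subseteq> U"
    using D(2) B_def by blast
  moreover have "\<forall>F c. finite F \<and> F \<subseteq> B \<and> (\<Sum>b\<in>F. c b *s b) \<in> W \<longrightarrow> (\<forall>b\<in>F. c b = 0)"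
    by (intro allI impI ballI, elim conjE) (rule indep)
  ultimately have "quotient_basis scale U W B"
    unfolding quotient_basis_def by (intro conjI ballI)
  then show ?thesis ..
qed

lemma (in vector_space) quotient_dim_add_dim:
  assumes U: "subspace U" and W: "subspace W" "W \<subseteq> U" and fin: "finite T" "U \<subseteq> span T"
  shows "quotient_dim scale U W + dim W = dim U"
proof -
  define B where "B = (SOME B. quotient_basis scale U W B)"
  have "quotient_basis scale U W B"
    unfolding B_def by (rule someI_ex, rule quotient_basis_exists[OF U W])
  then have BU: "B \<subseteq> U"
    and ind: "\<And>F c. finite F \<Longrightarrow> F \<subseteq> B \<Longrightarrow> (\<Sum>b\<in>F. c b *s b) \<in> W \<Longrightarrow> \<forall>b\<in>F. c b = 0"
    and gen: "\<And>u. u \<in> U \<Longrightarrow> \<exists>v\<in>span B. u - v \<in> W"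
    unfolding quotient_basis_def by blast+
  obtain C where C: "C \<subseteq> W" "independent C" "W \<subseteq> span C" "card C = dim W"
    using basis_exists by blast
  have CW: "span C = W"
    using C W(1) by (simp add: span_minimal subset_antisym)
  have disj: "B \<inter> C = {}"
  proof (rule ccontr)
    assume "B \<inter> C \<noteq> {}"
    then obtain b where "b \<in> B" "b \<in> C" by blast
    then show False
      using ind[of "{b}" "\<lambda>_. 1"] C(1) by auto
  qed
  have indep: "independent (C \<union> B)"
  proof
    assume "dependent (C \<union> B)"
    then obtain S c v where S: "finite S" "S \<subseteq> C \<union> B" "v \<in> S" "c v \<noteq> 0"
        "(\<Sum>x\<in>S. c x *s x) = 0"
      unfolding dependent_explicit by blast
    have "S = (S \<inter> B) \<union> (S \<inter> C)" "(S \<inter> B) \<inter> (S \<inter> C) = {}"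
      using S(2) disj by auto
    then have split: "(\<Sum>x\<in>S \<inter> B. c x *s x) + (\<Sum>x\<in>S \<inter> C. c x *s x) = 0"
      using S(1,5) sum.union_disjoint[of "S \<inter> B" "S \<inter> C" "\<lambda>x. c x *s x"] by simp
    have "(\<Sum>x\<in>S \<inter> C. c x *s x) \<in> W"
      unfolding CW[symmetric] by (intro span_sum span_scale span_base) blast
    moreover have "(\<Sum>x\<in>S \<inter> B. c x *s x) = - (\<Sum>x\<in>S \<inter> C. c x *s x)"
      using split by (simp add: eq_neg_iff_add_eq_0)
    ultimately have "(\<Sum>x\<in>S \<inter> B. c x *s x) \<in> W"
      using W(1) by (simp add: subspace_neg)
    then have zB: "\<forall>b\<in>S \<inter> B. c b = 0"
      using ind[of "S \<inter> B" c] S(1) by auto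
    then have "(\<Sum>x\<in>S \<inter> C. c x *s x) = 0"
      using split by simp
    then have "\<forall>b\<in>S \<inter> C. c b = 0"
      using C(2) S(1) independent_explicit_module[of C] by (metis Int_lower2 finite_Int)
    then show False
      using zB S(2,3,4) by blast
  qed
  have "U \<subseteq> span (C \<union> B)"
  proof
    fix u assume "u \<in> U"
    then obtain v where "v \<in> span B" "u - v \<in> span C"
      using gen CW by blast
    moreover have "u = (u - v) + v" by simp
    ultimately show "u \<in> span (C \<union> B)"
      unfolding span_Un by blast
  qed
  moreover have "C \<union> B \<subseteq> U"
    using BU C(1) W(2) by blast
  ultimately have "card (C \<union> B) = dim U"
    using indep by (intro basis_card_eq_dim)
  moreover have "finite (C \<union> B)"
    using independent_span_bound[OF fin(1) indep] \<open>C \<union> B \<subseteq> U\<close> fin(2) by blast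
  ultimately show ?thesis
    using disj C(4) unfolding quotient_dim_def B_def[symmetric]
    by (simp add: card_Un_disjoint Int_commute add.commute)
qed


section \<open>Polynomial identities and the PI-exponent\<close>

locale unital_algebra = vector_space scale
  for scale :: "'k::field \<Rightarrow> 'a::ring_1 \<Rightarrow> 'a" +
  assumes scale_mult_left: "scale c (x * y) = scale c x * y"
    and scale_mult_right: "scale c (x * y) = x * scale c y"
begin

definition evaluate :: "(nat \<Rightarrow> 'a) \<Rightarrow> 'k free_algebra \<Rightarrow> 'a" where
  "evaluate \<rho> f =
     (\<Sum>w\<in>Poly_Mapping.keys f. scale (Poly_Mapping.lookup f w) (prod_list (map \<rho> (letters w))))"

definition identities :: "'k free_algebra set" where
  "identities = {f. \<forall>\<rho>. evaluate \<rho> f = 0}"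

definition codimension :: "nat \<Rightarrow> nat" where
  "codimension n =
     quotient_dim fa_scale (multilinear_space n) (multilinear_space n \<inter> identities)"

text \<open>Unspecified unless the sequence converges.\<close>

definition PI_exponent :: real where
  "PI_exponent = lim (\<lambda>n. root n (real (codimension n)))"

definition finite_dimensional :: bool where
  "finite_dimensional \<longleftrightarrow> (\<exists>B. finite B \<and> span B = UNIV)"

end


section \<open>Regular quantum commutative algebras\<close>

text \<open>
  The components are indexed by \<open>{1..m}\<close>; values of \<open>R\<close> and \<open>\<theta>\<close> outside this range are irrelevant.
\<close>

locale regular_quantum_commutative_algebra = unital_algebra scale
  for scale :: "'k::field \<Rightarrow> 'a::ring_1 \<Rightarrow> 'a" +
  fixes m :: nat and R :: "nat \<Rightarrow> 'a set" and \<theta> :: "nat \<Rightarrow> nat \<Rightarrow> 'k"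
  assumes component_subspace: "i \<in> {1..m} \<Longrightarrow> subspace (R i)"
    and direct_sum: "\<exists>!r. r \<in> (\<Pi>\<^sub>E i\<in>{1..m}. R i) \<and> x = (\<Sum>i\<in>{1..m}. r i)"
    and regular: "set is \<subseteq> {1..m} \<Longrightarrow>
      \<exists>as. length as = length is \<and> (\<forall>j<length is. as ! j \<in> R (is ! j)) \<and> prod_list as \<noteq> 0"
    and theta_nonzero: "i \<in> {1..m} \<Longrightarrow> j \<in> {1..m} \<Longrightarrow> \<theta> i j \<noteq> 0"
    and quantum_commute: "i \<in> {1..m} \<Longrightarrow> j \<in> {1..m} \<Longrightarrow> a \<in> R i \<Longrightarrow> b \<in> R j \<Longrightarrow>
      a * b = scale (\<theta> i j) (b * a)"

text \<open>No two columns of the decomposition matrix with different indices are equal.\<close>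

definition minimal_decomposition :: "nat \<Rightarrow> (nat \<Rightarrow> nat \<Rightarrow> 'k) \<Rightarrow> bool" where
  "minimal_decomposition m \<theta> \<longleftrightarrow>
     (\<forall>j\<in>{1..m}. \<forall>k\<in>{1..m}. j \<noteq> k \<longrightarrow> \<not> (\<forall>i\<in>{1..m}. \<theta> i j = \<theta> i k))"

end

theory Submission
  imports Defs "HOL-Analysis.Convex"
begin

text \<open>
  The codimension \<open>c\<^sub>n\<close> lies between \<open>m\<^sup>n\<close> divided by a polynomial in \<open>n\<close> and \<open>m\<^sup>n\<close>, and \<open>n\<close>-th roots
  do not see polynomial factors.

  Upper bound (\<open>codimension_le_power\<close>). A multilinear polynomial is an identity as soon as it vanishes
  on homogeneous elements. Once the types \<open>i\<^sub>1, \<dots>, i\<^sub>n\<close> of these elements are chosen, quantum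
  commutativity makes every monomial a fixed scalar multiple of \<open>x\<^sub>1 \<cdots> x\<^sub>n\<close>, so that each of the
  \<open>m\<^sup>n\<close> choices of types imposes a single linear condition on the polynomial.

  Lower bound, algebraic part. By regularity there are homogeneous elements \<open>a\<^sub>1, \<dots>, a\<^sub>m\<close>, one of each
  type, and a nonzero subspace on which all of them act bijectively from the left
  (\<open>bijective_homogeneous_elements\<close>). A minimal nonzero subspace \<open>V\<close> that they preserve is irreducible,
  and on \<open>V\<close> the operators \<open>a\<^sub>i\<close> are linearly independent: commuting a linear relation past some \<open>a\<^sub>j\<close>
  rescales its terms by the inverses of the entries in row \<open>j\<close> of the decomposition matrix, and as
  the columns are distinct this separates the terms. Hence \<open>m \<le> d\<^sup>2\<close> where \<open>d = dim V\<close>. By Burnside's theorem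
  (\<open>burnside_matrix_units\<close>) every linear map of \<open>V\<close> is multiplication by an element of the algebra, so
  that the identities of the algebra hold for \<open>d \<times> d\<close> matrices.

  Lower bound, combinatorial part. It remains to bound the codimensions of \<open>d \<times> d\<close> matrices from
  below. The trace of \<open>x\<^bsub>\<sigma> 1\<^esub> \<cdots> x\<^bsub>\<sigma> n\<^esub> x\<^bsub>n+1\<^esub>\<close> at matrix units is, up to
  transposition, the matrix entry of the permutation \<open>(\<sigma> 1, \<dots>, \<sigma> n, n+1)\<close> acting on the
  \<open>(n+1)\<close>-st tensor power of a \<open>d\<close>-dimensional space, so \<open>c\<^sub>n\<close> is at least the rank of the family of
  operators given by these \<open>n!\<close> long cycles. Their Gram matrix \<open>G\<close> with respect to the trace form has the
  entries \<open>\<langle>\<zeta>, \<xi>\<rangle> = |{f. f \<circ> \<zeta> \<circ> \<xi>\<^sup>-\<^sup>1 = f}|\<close>, and its rank is at least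
  \<open>(tr G)\<^sup>2 / tr (G\<^sup>2)\<close>. Here \<open>tr G = n! d\<^bsup>n+1\<^esup>\<close>, while each row of \<open>G\<close> contributes to
  \<open>tr (G\<^sup>2)\<close> at most the sum over all permutations of the squared number of fixed functions. By
  Burnside's orbit counting that sum is \<open>(n+1)!\<close> times the number of multisets of \<open>n+1\<close> elements out of
  \<open>d\<^sup>2\<close>, which is polynomial in \<open>n\<close>. The result is
  \<open>d\<^bsup>2(n+1)\<^esup> \<le> c\<^sub>n (n+1) (n+2)\<^bsup>d d\<^esup>\<close> (\<open>codimension_ge\<close>). The Gram argument takes place over the
  reals, but the operators have matrix entries \<open>0\<close> and \<open>1\<close>, and the linear independence of such vectors
  passes to every field of characteristic \<open>0\<close>.
\<close>

section \<open>Linear systems and dimensions of quotients\<close>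

lemma homogeneous_system_nontrivial_solution:
  fixes a :: "'i \<Rightarrow> 'j \<Rightarrow> 'k::field"
  assumes "finite I" "finite J" "card I < card J"
  shows "\<exists>c. (\<exists>j\<in>J. c j \<noteq> 0) \<and> (\<forall>i\<in>I. (\<Sum>j\<in>J. c j * a i j) = 0)"
  using assms
proof (induction I arbitrary: J a rule: finite_induct)
  case empty
  then obtain j where "j \<in> J" by fastforce
  then show ?case by (intro exI[of _ "\<lambda>_. 1"]) auto
next
  case (insert i I)
  show ?case
  proof (cases "\<forall>j\<in>J. a i j = 0")
    case True
    have "card I < card J"
      using insert.hyps insert.prems(2) by simp
    then obtain c where "\<exists>j\<in>J. c j \<noteq> 0" "\<forall>i\<in>I. (\<Sum>j\<in>J. c j * a i j) = 0"
      using insert.IH[OF insert.prems(1)] by blast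
    moreover have "(\<Sum>j\<in>J. c j * a i j) = 0"
      using True by simp
    ultimately show ?thesis by blast
  next
    case False
    then obtain j0 where j0: "j0 \<in> J" "a i j0 \<noteq> 0" by blast
    define a' where "a' i' j = a i' j - a i' j0 * a i j / a i j0" for i' j
    have "card I < card (J - {j0})"
      using insert.hyps insert.prems j0 by (simp add: card_Diff_singleton)
    then obtain c where c: "\<exists>j\<in>J - {j0}. c j \<noteq> 0"
        "\<And>i. i \<in> I \<Longrightarrow> (\<Sum>j\<in>J - {j0}. c j * a' i j) = 0"
      using insert.IH[of "J - {j0}" a'] insert.prems(1) by blast
    define s where "s = (\<Sum>j\<in>J - {j0}. c j * a i j)"
    define c' where "c' = c(j0 := - s / a i j0)"
    have split: "(\<Sum>j\<in>J. c' j * a i' j) = - s / a i j0 * a i' j0 + (\<Sum>j\<in>J - {j0}. c j * a i' j)" for i'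
      using insert.prems(1) j0(1) by (simp add: sum.remove[of J j0] c'_def)
    have "(\<Sum>j\<in>J. c' j * a i' j) = 0" if "i' \<in> I" for i'
    proof -
      have "(\<Sum>j\<in>J - {j0}. c j * a i' j) - a i' j0 / a i j0 * s =
          (\<Sum>j\<in>J - {j0}. c j * a i' j - a i' j0 / a i j0 * (c j * a i j))"
        by (simp add: sum_subtractf s_def sum_distrib_left)
      also have "\<dots> = (\<Sum>j\<in>J - {j0}. c j * a' i' j)"
        by (intro sum.cong) (simp_all add: a'_def right_diff_distrib)
      also have "\<dots> = 0"
        using that by (rule c(2))
      finally show ?thesis unfolding split by simp
    qed
    moreover have "(\<Sum>j\<in>J. c' j * a i j) = 0"
      unfolding split using j0 by (simp add: s_def)
    moreover have "\<exists>j\<in>J. c' j \<noteq> 0"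
      using c(1) by (auto simp: c'_def)
    ultimately show ?thesis by blast
  qed
qed

context vector_space
begin

text \<open>
  If the functionals \<open>\<phi> i\<close> have their common kernel inside \<open>W\<close>, more than \<open>|I|\<close> basis vectors of \<open>U / W\<close> would have a
  nontrivial combination killed by all of them.
\<close>

lemma quotient_dim_le_card_functionals:
  assumes "subspace U" "subspace W" "W \<subseteq> U" "finite I"
    and lin: "\<And>i F c. finite F \<Longrightarrow> F \<subseteq> U \<Longrightarrow> \<phi> i (\<Sum>b\<in>F. c b *s b) = (\<Sum>b\<in>F. c b * \<phi> i b)"
    and ker: "\<And>u. u \<in> U \<Longrightarrow> (\<And>i. i \<in> I \<Longrightarrow> \<phi> i u = 0) \<Longrightarrow> u \<in> W"
  shows "quotient_dim scale U W \<le> card I"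
proof (rule ccontr)
  define B where "B = (SOME B. quotient_basis scale U W B)"
  have B: "quotient_basis scale U W B"
    unfolding B_def by (rule someI_ex, rule quotient_basis_exists[OF assms(1-3)])
  assume "\<not> ?thesis"
  then have less: "card I < card B"
    by (simp add: quotient_dim_def B_def)
  then have fin: "finite B"
    using card.infinite by fastforce
  from B have BU: "B \<subseteq> U"
    by (simp add: quotient_basis_def)
  obtain c where c: "\<exists>b\<in>B. c b \<noteq> 0" "\<And>i. i \<in> I \<Longrightarrow> (\<Sum>b\<in>B. c b * \<phi> i b) = 0"
    using homogeneous_system_nontrivial_solution[OF assms(4) fin less, of \<phi>] by blast
  have "(\<Sum>b\<in>B. c b *s b) \<in> W"
  proof (rule ker)
    show "(\<Sum>b\<in>B. c b *s b) \<in> U"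
      using BU by (intro subspace_sum[OF assms(1)] subspace_scale[OF assms(1)]) auto
  qed (simp add: lin[OF fin BU] c(2))
  moreover have "\<And>F c. finite F \<and> F \<subseteq> B \<and> (\<Sum>b\<in>F. c b *s b) \<in> W \<Longrightarrow> \<forall>b\<in>F. c b = 0"
    using B unfolding quotient_basis_def by meson
  ultimately show False
    using c(1) fin by (metis order_refl)
qed

lemma card_le_quotient_dim:
  assumes U: "subspace U" and W: "subspace W" "W \<subseteq> U" and T: "finite T" "U \<subseteq> span T"
    and F: "finite F" "\<And>i. i \<in> F \<Longrightarrow> b i \<in> U"
    and indep: "\<And>c. (\<Sum>i\<in>F. c i *s b i) \<in> W \<Longrightarrow> \<forall>i\<in>F. c i = 0"
  shows "card F \<le> quotient_dim scale U W"
proof (rule ccontr)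
  define B where "B = (SOME B. quotient_basis scale U W B)"
  have B: "quotient_basis scale U W B"
    unfolding B_def by (rule someI_ex, rule quotient_basis_exists[OF U W])
  have "independent B"
  proof
    assume "dependent B"
    then obtain S c where "finite S" "S \<subseteq> B" "\<exists>v\<in>S. c v \<noteq> 0" "(\<Sum>v\<in>S. c v *s v) = 0"
      unfolding dependent_explicit by blast
    moreover from this have "(\<Sum>v\<in>S. c v *s v) \<in> W"
      using subspace_0[OF W(1)] by simp
    moreover have "\<And>F c. finite F \<and> F \<subseteq> B \<and> (\<Sum>b\<in>F. c b *s b) \<in> W \<Longrightarrow> \<forall>b\<in>F. c b = 0"
      using B unfolding quotient_basis_def by meson
    ultimately show False
      by blast
  qed
  moreover have "B \<subseteq> span T"
    using B T(2) by (auto simp: quotient_basis_def)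
  ultimately have fin: "finite B"
    using independent_span_bound[OF T(1)] by blast
  assume "\<not> ?thesis"
  then have less: "card B < card F"
    by (simp add: quotient_dim_def B_def)
  have "\<exists>\<alpha>. b i - (\<Sum>\<beta>\<in>B. \<alpha> \<beta> *s \<beta>) \<in> W" if iF: "i \<in> F" for i
  proof -
    obtain v where "v \<in> span B" "b i - v \<in> W"
      using B F(2)[OF iF] unfolding quotient_basis_def by meson
    then show ?thesis
      using span_finite[OF fin] by auto
  qed
  then obtain \<alpha> where \<alpha>: "\<And>i. i \<in> F \<Longrightarrow> b i - (\<Sum>\<beta>\<in>B. \<alpha> i \<beta> *s \<beta>) \<in> W"
    by metis
  obtain c where c: "\<exists>i\<in>F. c i \<noteq> 0" "\<And>\<beta>. \<beta> \<in> B \<Longrightarrow> (\<Sum>i\<in>F. c i * \<alpha> i \<beta>) = 0"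
    using homogeneous_system_nontrivial_solution[OF fin F(1) less, of "\<lambda>\<beta> i. \<alpha> i \<beta>"] by blast
  have "(\<Sum>i\<in>F. c i *s (\<Sum>\<beta>\<in>B. \<alpha> i \<beta> *s \<beta>)) = (\<Sum>i\<in>F. \<Sum>\<beta>\<in>B. (c i * \<alpha> i \<beta>) *s \<beta>)"
    by (simp add: scale_sum_right)
  also have "\<dots> = (\<Sum>\<beta>\<in>B. \<Sum>i\<in>F. (c i * \<alpha> i \<beta>) *s \<beta>)"
    by (rule sum.swap)
  also have "\<dots> = 0"
    by (rule sum.neutral) (metis c(2) scale_sum_left scale_zero_left)
  finally have "(\<Sum>i\<in>F. c i *s b i) = (\<Sum>i\<in>F. c i *s (b i - (\<Sum>\<beta>\<in>B. \<alpha> i \<beta> *s \<beta>)))"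
    by (simp add: scale_right_diff_distrib sum_subtractf)
  also have "\<dots> \<in> W"
    using \<alpha> by (intro subspace_sum[OF W(1)] subspace_scale[OF W(1)])
  finally show False
    using indep[of c] c(1) by blast
qed

end


section \<open>Evaluating multilinear polynomials\<close>

lemma inj_on_permuted_words:
  "inj_on (\<lambda>\<sigma>. Word (map \<sigma> [0..<n])) {\<sigma>. \<sigma> permutes {..<n}}"
proof (rule inj_onI)
  fix \<sigma> \<tau> :: "nat \<Rightarrow> nat"
  assume *: "\<sigma> \<in> {\<sigma>. \<sigma> permutes {..<n}}" "\<tau> \<in> {\<sigma>. \<sigma> permutes {..<n}}"
    "Word (map \<sigma> [0..<n]) = Word (map \<tau> [0..<n])"
  show "\<sigma> = \<tau>"
  proof
    fix k show "\<sigma> k = \<tau> k"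
    proof (cases "k < n")
      case False
      then show ?thesis
        using * by (simp add: permutes_def)
    qed (use * in simp)
  qed
qed

text \<open>
  This reduces the evaluation of a multilinear polynomial to a sum over permutations.
\<close>

lemma keys_multilinear:
  assumes "f \<in> multilinear_space n"
  shows "Poly_Mapping.keys f \<subseteq> (\<lambda>\<sigma>. Word (map \<sigma> [0..<n])) ` {\<sigma>. \<sigma> permutes {..<n}}"
  using assms unfolding multilinear_space_def
proof (induction rule: free_algebra.span_induct_alt)
  case (step c x y)
  have "Poly_Mapping.keys (fa_scale c x + y) \<subseteq> Poly_Mapping.keys (fa_scale c x) \<union> Poly_Mapping.keys y"
    by (rule keys_add)
  moreover have "Poly_Mapping.keys (fa_scale c x) \<subseteq> Poly_Mapping.keys x"
    by (auto simp: in_keys_iff)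
  moreover have "Poly_Mapping.keys x \<subseteq> (\<lambda>\<sigma>. Word (map \<sigma> [0..<n])) ` {\<sigma>. \<sigma> permutes {..<n}}"
    using step(1) by (auto simp: fa_monomial_def)
  ultimately show ?case using step(2) by blast
qed simp

context unital_algebra
begin

text \<open>
  Summing over a larger set of words makes evaluation visibly linear.
\<close>

lemma evaluate_superset:
  assumes "finite T" "Poly_Mapping.keys f \<subseteq> T"
  shows "evaluate \<rho> f = (\<Sum>w\<in>T. scale (Poly_Mapping.lookup f w) (prod_list (map \<rho> (letters w))))"
  unfolding evaluate_def using assms
  by (intro sum.mono_neutral_left) (auto simp: in_keys_iff)

lemma evaluate_multilinear:
  assumes "f \<in> multilinear_space n"
  shows "evaluate \<rho> f = (\<Sum>\<sigma> | \<sigma> permutes {..<n}.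
    scale (Poly_Mapping.lookup f (Word (map \<sigma> [0..<n]))) (prod_list (map \<rho> (map \<sigma> [0..<n]))))"
  using evaluate_superset[OF _ keys_multilinear[OF assms], of \<rho>]
  by (simp add: finite_permutations sum.reindex[OF inj_on_permuted_words])

lemma evaluate_add: "evaluate \<rho> (f + g) = evaluate \<rho> f + evaluate \<rho> g"
proof -
  let ?T = "Poly_Mapping.keys f \<union> Poly_Mapping.keys g"
  have "Poly_Mapping.keys (f + g) \<subseteq> ?T" by (rule keys_add)
  then show ?thesis
    by (simp add: evaluate_superset[of ?T] lookup_add scale_left_distrib sum.distrib)
qed

lemma evaluate_scale: "evaluate \<rho> (fa_scale c f) = scale c (evaluate \<rho> f)"
proof -
  have "Poly_Mapping.keys (fa_scale c f) \<subseteq> Poly_Mapping.keys f"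
    by (auto simp: in_keys_iff)
  then show ?thesis
    by (simp add: evaluate_superset[of "Poly_Mapping.keys f"] scale_sum_right)
qed

lemma evaluate_monomial: "evaluate \<rho> (fa_monomial xs) = prod_list (map \<rho> xs)"
  by (simp add: evaluate_def fa_monomial_def)

lemma evaluate_sum: "evaluate \<rho> (\<Sum>i\<in>F. g i) = (\<Sum>i\<in>F. evaluate \<rho> (g i))"
proof (induction F rule: infinite_finite_induct)
  case (insert x F)
  then show ?case by (simp add: evaluate_add)
qed (simp_all add: evaluate_def)

lemma subspace_identities: "free_algebra.subspace identities"
  unfolding free_algebra.subspace_def identities_def
  by (auto simp: evaluate_add evaluate_scale) (simp add: evaluate_def)

lemma subspace_multilinear: "free_algebra.subspace (multilinear_space n)"
  unfolding multilinear_space_def by (rule free_algebra.subspace_span)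

end

lemma prod_list_sum_expand:
  fixes g :: "'i \<Rightarrow> 't \<Rightarrow> 'a::ring_1"
  assumes "distinct w"
  shows "prod_list (map (\<lambda>k. \<Sum>t\<in>S. g k t) w) =
    (\<Sum>s\<in>set w \<rightarrow>\<^sub>E S. prod_list (map (\<lambda>k. g k (s k)) w))"
  using assms
proof (induction w)
  case (Cons x w)
  have "(\<Sum>s\<in>set (x # w) \<rightarrow>\<^sub>E S. prod_list (map (\<lambda>k. g k (s k)) (x # w))) =
    (\<Sum>(t, s)\<in>S \<times> (set w \<rightarrow>\<^sub>E S). prod_list (map (\<lambda>k. g k ((s(x := t)) k)) (x # w)))"
    unfolding list.set(2) PiE_insert_eq
    by (subst sum.reindex) (use Cons.prems inj_combinator[of x "set w" "\<lambda>_. S"] in \<open>auto simp: case_prod_unfold\<close>)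
  also have "\<dots> = (\<Sum>(t, s)\<in>S \<times> (set w \<rightarrow>\<^sub>E S). g x t * prod_list (map (\<lambda>k. g k (s k)) w))"
  proof (rule sum.cong[OF refl], clarify)
    fix t s
    have "map (\<lambda>k. g k ((s(x := t)) k)) (x # w) = g x t # map (\<lambda>k. g k (s k)) w"
      using Cons.prems by auto
    then show "prod_list (map (\<lambda>k. g k ((s(x := t)) k)) (x # w)) = g x t * prod_list (map (\<lambda>k. g k (s k)) w)"
      by (simp only: prod_list.Cons)
  qed
  also have "\<dots> = (\<Sum>t\<in>S. g x t) * (\<Sum>s\<in>set w \<rightarrow>\<^sub>E S. prod_list (map (\<lambda>k. g k (s k)) w))"
    by (simp add: sum_product sum.cartesian_product)
  finally show ?case using Cons by simp
qed simp


section \<open>The upper bound for the codimensions\<close>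

context regular_quantum_commutative_algebra
begin

text \<open>
  The letters of a word are abstract indices \<open>k\<close> with prescribed types \<open>t k\<close>, so that the scalar is seen to
  depend on the types alone and not on the elements \<open>\<rho> k\<close> substituted for the letters.
\<close>

lemma move_factor_right:
  assumes "t x \<in> {1..m}" "\<And>k. k \<in> set ys \<Longrightarrow> t k \<in> {1..m}"
  shows "\<exists>c. c \<noteq> 0 \<and> (\<forall>\<rho>. \<rho> x \<in> R (t x) \<longrightarrow> (\<forall>k\<in>set ys. \<rho> k \<in> R (t k)) \<longrightarrow>
    \<rho> x * prod_list (map \<rho> ys) = scale c (prod_list (map \<rho> ys) * \<rho> x))"
  using assms(2)
proof (induction ys)
  case Nil
  show ?case by (intro exI[of _ 1]) simp
next
  case (Cons y ys)
  then obtain c where c: "c \<noteq> 0" "\<And>\<rho>. \<rho> x \<in> R (t x) \<Longrightarrow> \<forall>k\<in>set ys. \<rho> k \<in> R (t k) \<Longrightarrow>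
    \<rho> x * prod_list (map \<rho> ys) = scale c (prod_list (map \<rho> ys) * \<rho> x)"
    by fastforce
  have "\<rho> x * prod_list (map \<rho> (y # ys)) =
      scale (\<theta> (t x) (t y) * c) (prod_list (map \<rho> (y # ys)) * \<rho> x)"
    if "\<rho> x \<in> R (t x)" "\<forall>k\<in>set (y # ys). \<rho> k \<in> R (t k)" for \<rho>
  proof -
    have "\<rho> x * prod_list (map \<rho> (y # ys)) = (\<rho> x * \<rho> y) * prod_list (map \<rho> ys)"
      by (simp add: mult.assoc)
    also have "\<rho> x * \<rho> y = scale (\<theta> (t x) (t y)) (\<rho> y * \<rho> x)"
      using that Cons.prems assms(1) by (intro quantum_commute) auto
    also have "\<dots> * prod_list (map \<rho> ys) =
        scale (\<theta> (t x) (t y)) (\<rho> y * (\<rho> x * prod_list (map \<rho> ys)))"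
      by (simp add: mult.assoc flip: scale_mult_left)
    also have "\<rho> x * prod_list (map \<rho> ys) = scale c (prod_list (map \<rho> ys) * \<rho> x)"
      using that by (intro c(2)) auto
    finally show ?thesis
      by (simp add: mult.assoc flip: scale_mult_right)
  qed
  moreover have "\<theta> (t x) (t y) * c \<noteq> 0"
    using theta_nonzero[OF assms(1)] Cons.prems c(1) by simp
  ultimately show ?case by blast
qed

text \<open>
  The scalar is a product of values of \<open>\<theta>\<close>, one for each pair of letters whose order changes.
\<close>

lemma reorder_factors:
  assumes "mset w = mset w'" "\<And>k. k \<in> set w \<Longrightarrow> t k \<in> {1..m}"
  shows "\<exists>c. c \<noteq> 0 \<and> (\<forall>\<rho>. (\<forall>k\<in>set w. \<rho> k \<in> R (t k)) \<longrightarrow>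
    prod_list (map \<rho> w) = scale c (prod_list (map \<rho> w')))"
  using assms
proof (induction w arbitrary: w')
  case Nil
  then show ?case by (intro exI[of _ 1]) simp
next
  case (Cons x xs)
  then have "x \<in> set w'"
    by (metis list.set_intros(1) set_mset_mset)
  then obtain ys zs where w': "w' = ys @ x # zs"
    by (meson split_list)
  with Cons.prems have mset: "mset xs = mset (ys @ zs)" by simp
  then have sets: "set xs = set ys \<union> set zs"
    by (metis set_append set_mset_mset)
  obtain c where c: "c \<noteq> 0" "\<And>\<rho>. \<forall>k\<in>set xs. \<rho> k \<in> R (t k) \<Longrightarrow>
    prod_list (map \<rho> xs) = scale c (prod_list (map \<rho> (ys @ zs)))"
    using Cons.IH[OF mset] Cons.prems(2) by force
  obtain c' where c': "c' \<noteq> 0" "\<And>\<rho>. \<rho> x \<in> R (t x) \<Longrightarrow> \<forall>k\<in>set ys. \<rho> k \<in> R (t k) \<Longrightarrow>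
    \<rho> x * prod_list (map \<rho> ys) = scale c' (prod_list (map \<rho> ys) * \<rho> x)"
    using move_factor_right[of t x ys] Cons.prems(2) sets by force
  have "prod_list (map \<rho> (x # xs)) = scale (c * c') (prod_list (map \<rho> w'))"
    if "\<forall>k\<in>set (x # xs). \<rho> k \<in> R (t k)" for \<rho>
  proof -
    have "prod_list (map \<rho> (x # xs)) = \<rho> x * scale c (prod_list (map \<rho> (ys @ zs)))"
      using c(2)[of \<rho>] that by simp
    also have "\<dots> = scale c ((\<rho> x * prod_list (map \<rho> ys)) * prod_list (map \<rho> zs))"
      by (simp add: mult.assoc flip: scale_mult_right)
    also have "\<rho> x * prod_list (map \<rho> ys) = scale c' (prod_list (map \<rho> ys) * \<rho> x)"
      using that sets by (intro c'(2)) auto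
    finally show ?thesis
      by (simp add: w' mult.assoc flip: scale_mult_left)
  qed
  then show ?case using c(1) c'(1) by (intro exI[of _ "c * c'"]) auto
qed

lemma homogeneous_decomposition:
  obtains r where "\<And>t. t \<in> {1..m} \<Longrightarrow> r t \<in> R t" "x = (\<Sum>t\<in>{1..m}. r t)"
proof -
  obtain r where "r \<in> (\<Pi>\<^sub>E i\<in>{1..m}. R i)" "x = (\<Sum>i\<in>{1..m}. r i)"
    using direct_sum[of x] by blast
  then show ?thesis by (intro that[of r]) (auto simp: PiE_iff)
qed

text \<open>
  For each assignment \<open>t\<close> of types, let \<open>\<epsilon> t \<sigma>\<close> be the scalar that reorders the monomial of \<open>\<sigma>\<close>. The
  functional \<open>\<phi> t\<close> computes the coefficient of \<open>x\<^sub>1 \<cdots> x\<^sub>n\<close> in a polynomial after reordering all of its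
  monomials. A polynomial killed by all \<open>\<phi> t\<close> vanishes on homogeneous elements, hence everywhere by
  multilinearity.
\<close>

theorem codimension_le_power: "codimension n \<le> m ^ n"
proof -
  let ?P = "{\<sigma>. \<sigma> permutes {..<n}}" and ?w = "\<lambda>\<sigma>. map \<sigma> [0..<n]"
  have mset: "mset (?w \<sigma>) = mset [0..<n]" if "\<sigma> permutes {..<n}" for \<sigma>
    using permutes_image_mset[OF that] by (simp add: atLeast0LessThan)
  have "\<forall>t \<sigma>. \<exists>c. t \<in> {..<n} \<rightarrow>\<^sub>E {1..m} \<longrightarrow> \<sigma> permutes {..<n} \<longrightarrow>
      (\<forall>\<rho>. (\<forall>k<n. \<rho> k \<in> R (t k)) \<longrightarrow> prod_list (map \<rho> (?w \<sigma>)) = scale c (prod_list (map \<rho> [0..<n])))"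
  proof (intro allI)
    fix t :: "nat \<Rightarrow> nat" and \<sigma>
    show "\<exists>c. t \<in> {..<n} \<rightarrow>\<^sub>E {1..m} \<longrightarrow> \<sigma> permutes {..<n} \<longrightarrow>
      (\<forall>\<rho>. (\<forall>k<n. \<rho> k \<in> R (t k)) \<longrightarrow> prod_list (map \<rho> (?w \<sigma>)) = scale c (prod_list (map \<rho> [0..<n])))"
    proof (cases "t \<in> {..<n} \<rightarrow>\<^sub>E {1..m} \<and> \<sigma> permutes {..<n}")
      case True
      have "set (?w \<sigma>) = {..<n}"
        using mset_eq_setD[OF mset[of \<sigma>]] True by (simp add: atLeast0LessThan)
      then show ?thesis
        using reorder_factors[OF mset[of \<sigma>], of t] True by (auto simp: PiE_iff)
    qed blast
  qed
  then obtain \<epsilon> where \<epsilon>: "\<And>t \<sigma> \<rho>. t \<in> {..<n} \<rightarrow>\<^sub>E {1..m} \<Longrightarrow> \<sigma> permutes {..<n} \<Longrightarrow>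
      (\<forall>k<n. \<rho> k \<in> R (t k)) \<Longrightarrow> prod_list (map \<rho> (?w \<sigma>)) = scale (\<epsilon> t \<sigma>) (prod_list (map \<rho> [0..<n]))"
    unfolding choice_iff by blast
  define \<phi> where "\<phi> t f = (\<Sum>\<sigma>\<in>?P. Poly_Mapping.lookup f (Word (?w \<sigma>)) * \<epsilon> t \<sigma>)" for t f
  have "codimension n \<le> card ({..<n} \<rightarrow>\<^sub>E {1..m})"
    unfolding codimension_def
  proof (rule free_algebra.quotient_dim_le_card_functionals[where \<phi> = \<phi>])
    show "free_algebra.subspace (multilinear_space n \<inter> identities)"
      by (intro free_algebra.subspace_inter subspace_multilinear subspace_identities)
    show "finite ({..<n} \<rightarrow>\<^sub>E {1..m})"
      by (intro finite_PiE) auto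
    show "\<phi> t (\<Sum>b\<in>F. fa_scale (c b) b) = (\<Sum>b\<in>F. c b * \<phi> t b)" for t F c
      unfolding \<phi>_def lookup_sum lookup_fa_scale sum_distrib_left sum_distrib_right
      by (subst sum.swap) (simp add: mult.assoc)
    fix f assume f: "f \<in> multilinear_space n" and \<phi>0: "\<And>t. t \<in> {..<n} \<rightarrow>\<^sub>E {1..m} \<Longrightarrow> \<phi> t f = 0"
    have "evaluate \<rho> f = 0" for \<rho>
    proof -
      have "\<forall>k. \<exists>r. (\<forall>t\<in>{1..m}. r t \<in> R t) \<and> \<rho> k = (\<Sum>t\<in>{1..m}. r t)"
        using homogeneous_decomposition by metis
      then obtain r where "\<forall>k. (\<forall>t\<in>{1..m}. r k t \<in> R t) \<and> \<rho> k = (\<Sum>t\<in>{1..m}. r k t)"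
        unfolding choice_iff ..
      then have r: "\<And>k t. t \<in> {1..m} \<Longrightarrow> r k t \<in> R t" "\<And>k. \<rho> k = (\<Sum>t\<in>{1..m}. r k t)"
        by blast+
      have "prod_list (map \<rho> (?w \<sigma>)) =
          (\<Sum>t\<in>{..<n} \<rightarrow>\<^sub>E {1..m}. scale (\<epsilon> t \<sigma>) (prod_list (map (\<lambda>k. r k (t k)) [0..<n])))"
        if \<sigma>: "\<sigma> \<in> ?P" for \<sigma>
      proof -
        have d: "distinct (?w \<sigma>)" and s: "set (?w \<sigma>) = {..<n}"
          using mset_eq_imp_distinct_iff[OF mset[of \<sigma>]] mset_eq_setD[OF mset[of \<sigma>]] \<sigma>
          by (simp_all add: atLeast0LessThan)
        have "prod_list (map \<rho> (?w \<sigma>)) =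
            (\<Sum>t\<in>{..<n} \<rightarrow>\<^sub>E {1..m}. prod_list (map (\<lambda>k. r k (t k)) (?w \<sigma>)))"
          using prod_list_sum_expand[OF d, of r "{1..m}"] unfolding s r(2)[symmetric] by simp
        also have "\<dots> = (\<Sum>t\<in>{..<n} \<rightarrow>\<^sub>E {1..m}. scale (\<epsilon> t \<sigma>) (prod_list (map (\<lambda>k. r k (t k)) [0..<n])))"
          using \<sigma> r(1) by (intro sum.cong refl \<epsilon>) (auto simp: PiE_iff)
        finally show ?thesis .
      qed
      then have "evaluate \<rho> f = (\<Sum>\<sigma>\<in>?P. \<Sum>t\<in>{..<n} \<rightarrow>\<^sub>E {1..m}.
          scale (Poly_Mapping.lookup f (Word (?w \<sigma>)) * \<epsilon> t \<sigma>) (prod_list (map (\<lambda>k. r k (t k)) [0..<n])))"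
        unfolding evaluate_multilinear[OF f] by (intro sum.cong refl) (simp add: scale_sum_right)
      also have "\<dots> = (\<Sum>t\<in>{..<n} \<rightarrow>\<^sub>E {1..m}. \<Sum>\<sigma>\<in>?P.
          scale (Poly_Mapping.lookup f (Word (?w \<sigma>)) * \<epsilon> t \<sigma>) (prod_list (map (\<lambda>k. r k (t k)) [0..<n])))"
        by (rule sum.swap)
      also have "\<dots> = (\<Sum>t\<in>{..<n} \<rightarrow>\<^sub>E {1..m}. scale (\<phi> t f) (prod_list (map (\<lambda>k. r k (t k)) [0..<n])))"
        by (simp add: \<phi>_def scale_sum_left)
      finally show ?thesis using \<phi>0 by simp
    qed
    then show "f \<in> multilinear_space n \<inter> identities"
      using f by (simp add: identities_def)
  qed (simp_all add: subspace_multilinear)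
  then show ?thesis
    by (simp add: card_PiE)
qed

end


section \<open>Irreducible invariant subspaces\<close>

locale finite_dimensional_algebra = unital_algebra scale + finite_dimensional_vector_space scale Basis
  for scale :: "'k::field \<Rightarrow> 'a::ring_1 \<Rightarrow> 'a" and Basis
begin

lemma subspace_left_multiples:
  assumes "subspace U"
  shows "subspace ((*) a ` U)"
  unfolding subspace_def
proof (intro conjI ballI allI)
  show "0 \<in> (*) a ` U"
    using subspace_0[OF assms] by (metis image_eqI mult_zero_right)
  show "x + y \<in> (*) a ` U" if "x \<in> (*) a ` U" "y \<in> (*) a ` U" for x y
    using that subspace_add[OF assms] by (auto simp flip: distrib_left)
  show "scale c x \<in> (*) a ` U" if "x \<in> (*) a ` U" for c x
    using that subspace_scale[OF assms] by (auto simp: scale_mult_right)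
qed

lemma mult_sum_scale: "a * (\<Sum>x\<in>C. scale (c x) (f x)) = (\<Sum>x\<in>C. scale (c x) (a * f x))"
  by (simp add: sum_distrib_left scale_mult_right)

text \<open>
  A surjective endomorphism of a finite-dimensional space maps a basis to a basis.
\<close>

lemma left_mult_surj_imp_inj:
  assumes U: "subspace U" and surj: "(*) a ` U = U" and v: "v \<in> U" "a * v = 0"
  shows "v = 0"
proof -
  obtain C where C: "C \<subseteq> U" "independent C" "U \<subseteq> span C" "card C = dim U"
    using basis_exists by blast
  have fin: "finite C"
    using C(2) by (rule finiteI_independent)
  have "span C = U"
    using C U by (simp add: span_minimal subset_antisym)
  have "U \<subseteq> span ((*) a ` C)"
  proof
    fix u assume "u \<in> U"
    then obtain w where "w \<in> span C" "u = a * w"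
      using surj C(3) by blast
    then obtain c where "u = a * (\<Sum>x\<in>C. scale (c x) x)"
      using span_finite[OF fin] by auto
    then have "u = (\<Sum>x\<in>C. scale (c x) (a * x))"
      by (simp add: mult_sum_scale)
    then show "u \<in> span ((*) a ` C)"
      by (simp add: span_sum span_scale span_base)
  qed
  then have le: "dim U \<le> card ((*) a ` C)"
    using dim_le_card fin by blast
  then have inj: "inj_on ((*) a) C"
    using C(4) card_image_le[OF fin, of "(*) a"] by (intro eq_card_imp_inj_on fin) simp
  have "independent ((*) a ` C)"
  proof (rule card_le_dim_spanning[of _ U])
    show "(*) a ` C \<subseteq> U" using C(1) surj by blast
    show "card ((*) a ` C) \<le> dim U"
      using C(4) card_image_le[OF fin, of "(*) a"] by simp
  qed (use fin \<open>U \<subseteq> span ((*) a ` C)\<close> in auto)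
  obtain c where c: "v = (\<Sum>x\<in>C. scale (c x) x)"
    using v(1) C(3) span_finite[OF fin] by auto
  then have 0: "(\<Sum>x\<in>C. scale (c x) (a * x)) = 0"
    using v(2) by (simp add: mult_sum_scale)
  have "(\<Sum>y\<in>(*) a ` C. scale (c (the_inv_into C ((*) a) y)) y) = 0"
    using 0 by (simp add: sum.reindex[OF inj] the_inv_into_f_f[OF inj])
  then have "\<forall>y\<in>(*) a ` C. c (the_inv_into C ((*) a) y) = 0"
    using \<open>independent ((*) a ` C)\<close> fin unfolding independent_explicit_module by (meson finite_imageI order_refl)
  then have "\<forall>x\<in>C. c x = 0"
    by (simp add: the_inv_into_f_f[OF inj])
  then show "v = 0"
    using c by simp
qed

definition stabilizer :: "'a set \<Rightarrow> 'a set" where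
  "stabilizer V = {r. \<forall>v\<in>V. r * v \<in> V}"

text \<open>
  A simple module over the algebra \<open>stabilizer V\<close>, realized inside the left regular module.
\<close>

definition irreducible_subspace :: "'a set \<Rightarrow> bool" where
  "irreducible_subspace V \<longleftrightarrow> subspace V \<and> V \<noteq> {0} \<and>
    (\<forall>W. subspace W \<longrightarrow> W \<subseteq> V \<longrightarrow> (\<forall>r\<in>stabilizer V. \<forall>w\<in>W. r * w \<in> W) \<longrightarrow> W = {0} \<or> W = V)"

end

locale finite_dimensional_regular_algebra =
  regular_quantum_commutative_algebra scale m R \<theta> + finite_dimensional_algebra scale Basis
  for scale :: "'k::field \<Rightarrow> 'a::ring_1 \<Rightarrow> 'a" and m R \<theta> Basis
begin

definition homogeneous :: "('a \<times> nat) list \<Rightarrow> bool" where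
  "homogeneous ps \<longleftrightarrow> (\<forall>(a, t)\<in>set ps. t \<in> {1..m} \<and> a \<in> R t)"

abbreviation product :: "('a \<times> nat) list \<Rightarrow> 'a" where
  "product ps \<equiv> prod_list (map fst ps)"

text \<open>
  A homogeneous product that can be prolonged without vanishing by factors of arbitrarily prescribed types;
  \<open>regular\<close> says that the empty product is of this kind.
\<close>

definition persistent :: "('a \<times> nat) list \<Rightarrow> bool" where
  "persistent ps \<longleftrightarrow> homogeneous ps \<and> (\<forall>ts. set ts \<subseteq> {1..m} \<longrightarrow>
    (\<exists>qs. homogeneous qs \<and> map snd qs = ts \<and> product (ps @ qs) \<noteq> 0))"

lemma persistentE:
  assumes "persistent ps" "set ts \<subseteq> {1..m}"
  obtains qs where "homogeneous qs" "map snd qs = ts" "product (ps @ qs) \<noteq> 0"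
  using assms unfolding persistent_def by meson

text \<open>
  This is \<open>reorder_factors\<close> with the pairs of an element and its type as letters.
\<close>

lemma reorder_product:
  assumes "homogeneous ps" "mset ps = mset qs"
  shows "\<exists>c. c \<noteq> 0 \<and> product ps = scale c (product qs)"
proof -
  have "\<exists>c. c \<noteq> 0 \<and> (\<forall>\<rho>. (\<forall>k\<in>set ps. \<rho> k \<in> R (snd k)) \<longrightarrow>
      prod_list (map \<rho> ps) = scale c (prod_list (map \<rho> qs)))"
    using assms by (intro reorder_factors) (auto simp: homogeneous_def)
  moreover have "\<forall>k\<in>set ps. fst k \<in> R (snd k)"
    using assms(1) by (auto simp: homogeneous_def)
  ultimately show ?thesis by blast
qed

lemma persistent_Nil: "persistent []"
  unfolding persistent_def
proof (intro conjI allI impI)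
  fix ts assume ts: "set ts \<subseteq> {1..m}"
  then obtain as where as: "length as = length ts" "\<forall>j<length ts. as ! j \<in> R (ts ! j)" "prod_list as \<noteq> 0"
    using regular by blast
  have "homogeneous (zip as ts)"
    using as(1,2) ts by (auto simp: homogeneous_def in_set_zip subset_iff)
  with as show "\<exists>qs. homogeneous qs \<and> map snd qs = ts \<and> product ([] @ qs) \<noteq> 0"
    by (intro exI[of _ "zip as ts"]) simp
qed (simp add: homogeneous_def)

text \<open>
  If no basis element of \<open>R t\<close> could be appended, each would have a word of types along which it dies. As
  factors may be reordered, the concatenation of these finitely many words kills every basis element, hence
  all of \<open>R t\<close>, contrary to the persistence of \<open>ps\<close>.
\<close>

lemma persistent_snoc:
  assumes ps: "persistent ps" and t: "t \<in> {1..m}"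
  shows "\<exists>a\<in>R t. persistent (ps @ [(a, t)])"
proof (rule ccontr)
  assume *: "\<not> ?thesis"
  obtain B where B: "B \<subseteq> R t" "independent B" "R t \<subseteq> span B"
    using maximal_independent_subset by blast
  have fin: "finite B"
    using B(2) by (rule finiteI_independent)
  obtain bs where bs: "set bs = B"
    using finite_list[OF fin] by blast
  have hom: "homogeneous (ps @ [(a, t)])" if "a \<in> B" for a
    using ps t B(1) that by (auto simp: persistent_def homogeneous_def)
  have "\<forall>a. \<exists>ts. a \<in> B \<longrightarrow> set ts \<subseteq> {1..m} \<and>
      (\<forall>qs. homogeneous qs \<longrightarrow> map snd qs = ts \<longrightarrow> product (ps @ [(a, t)] @ qs) = 0)"
    using * B(1) hom unfolding persistent_def by fastforce
  then obtain w where w: "\<And>a. a \<in> B \<Longrightarrow> set (w a) \<subseteq> {1..m}"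
    "\<And>a qs. a \<in> B \<Longrightarrow> homogeneous qs \<Longrightarrow> map snd qs = w a \<Longrightarrow> product (ps @ [(a, t)] @ qs) = 0"
    unfolding choice_iff by blast
  have "set (t # concat (map w bs)) \<subseteq> {1..m}"
    using t w(1) bs by auto
  then obtain qs0 where qs0: "homogeneous qs0" "map snd qs0 = t # concat (map w bs)" "product (ps @ qs0) \<noteq> 0"
    by (rule persistentE[OF ps])
  then obtain x qs where qs: "qs0 = (x, t) # qs" "map snd qs = concat (map w bs)"
    by (auto simp: map_eq_Cons_conv)
  have "x \<in> span B"
    using qs0(1) B(3) by (auto simp: homogeneous_def qs(1))
  then obtain \<kappa> where \<kappa>: "x = (\<Sum>a\<in>B. scale (\<kappa> a) a)"
    using span_finite[OF fin] by auto
  have "product (ps @ qs0) = product ps * x * product qs"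
    by (simp add: qs(1) mult.assoc)
  also have "\<dots> = (\<Sum>a\<in>B. scale (\<kappa> a) (product ps * a * product qs))"
    by (simp add: \<kappa> sum_distrib_left sum_distrib_right flip: scale_mult_left scale_mult_right)
  finally have "(\<Sum>a\<in>B. scale (\<kappa> a) (product ps * a * product qs)) \<noteq> 0"
    using qs0(3) by simp
  then obtain a where a: "a \<in> B" "product ps * a * product qs \<noteq> 0"
    by (metis (no_types, lifting) scale_zero_right sum.neutral)
  obtain b1 b2 where b: "bs = b1 @ a # b2"
    using a(1) bs by (meson split_list)
  have "map snd qs = concat (map w b1) @ w a @ concat (map w b2)"
    using qs(2) b by simp
  then obtain u v z where uvz: "qs = u @ v @ z" "map snd v = w a"
    by (auto simp: map_eq_append_conv append_eq_map_conv)
  have hqs: "homogeneous qs"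
    using qs0(1) by (auto simp: homogeneous_def qs(1))
  then have "homogeneous (ps @ [(a, t)] @ qs)" "homogeneous v"
    using hom[OF a(1)] by (auto simp: homogeneous_def uvz(1))
  moreover have "mset (ps @ [(a, t)] @ qs) = mset (ps @ [(a, t)] @ v @ u @ z)"
    by (simp add: uvz(1))
  ultimately obtain c where "product (ps @ [(a, t)] @ qs) = scale c (product (ps @ [(a, t)] @ v @ u @ z))"
    using reorder_product by blast
  also have "\<dots> = scale c (product (ps @ [(a, t)] @ v) * product (u @ z))"
    by (simp add: mult.assoc)
  also have "\<dots> = 0"
    using w(2)[OF a(1) \<open>homogeneous v\<close> uvz(2)] by simp
  finally show False
    using a(2) by (simp add: mult.assoc)
qed

text \<open>
  Choose a persistent product \<open>b\<close> for which the right ideal \<open>U\<close> of its multiples has minimal dimension.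
  Appending a factor \<open>a t\<close> that keeps the product persistent cannot shrink that ideal, and as \<open>a t\<close>
  commutes with \<open>b\<close> up to a nonzero scalar, left multiplication by \<open>a t\<close> maps \<open>U\<close> onto itself.
\<close>

lemma bijective_homogeneous_elements:
  obtains U a where "subspace U" "U \<noteq> {0}"
    "\<And>t. t \<in> {1..m} \<Longrightarrow> a t \<in> R t" "\<And>t. t \<in> {1..m} \<Longrightarrow> (*) (a t) ` U = U"
proof -
  define rank where "rank ps = dim (range ((*) (product ps)))" for ps
  obtain ps where ps: "persistent ps" and min: "\<And>qs. persistent qs \<Longrightarrow> rank ps \<le> rank qs"
    using ex_has_least_nat[of persistent "[]" rank] persistent_Nil by blast
  define b where "b = product ps"
  define U where "U = range ((*) b)"
  have U: "subspace U"
    unfolding U_def by (rule subspace_left_multiples) simp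
  have "b \<noteq> 0"
    using persistentE[OF ps, of "[]"] by (auto simp: b_def)
  moreover have "b \<in> U"
    unfolding U_def by (metis mult.right_neutral rangeI)
  ultimately have "U \<noteq> {0}" by blast
  have "\<forall>t. \<exists>a. t \<in> {1..m} \<longrightarrow> a \<in> R t \<and> persistent (ps @ [(a, t)])"
    using persistent_snoc[OF ps] by blast
  then obtain a where a: "\<And>t. t \<in> {1..m} \<Longrightarrow> a t \<in> R t" "\<And>t. t \<in> {1..m} \<Longrightarrow> persistent (ps @ [(a t, t)])"
    unfolding choice_iff by blast
  have surj: "(*) (a t) ` U = U" if t: "t \<in> {1..m}" for t
  proof -
    have eq: "range ((*) (b * a t)) = U"
    proof (rule subspace_dim_equal)
      show "range ((*) (b * a t)) \<subseteq> U"
        unfolding U_def by (auto simp: mult.assoc)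
      show "dim U \<le> dim (range ((*) (b * a t)))"
        using min[OF a(2)[OF t]] by (simp add: rank_def U_def b_def)
    qed (use U in \<open>auto intro: subspace_left_multiples\<close>)
    have "homogeneous ((a t, t) # ps)"
      using ps t a(1) by (auto simp: persistent_def homogeneous_def)
    then obtain c where c: "c \<noteq> 0" "a t * b = scale c (b * a t)"
      using reorder_product[of "(a t, t) # ps" "ps @ [(a t, t)]"] by (auto simp: b_def)
    have "(*) (a t) ` U = range (\<lambda>r. scale c (b * a t * r))"
      unfolding U_def by (simp add: image_image scale_mult_left c(2) flip: mult.assoc)
    also have "\<dots> = scale c ` U"
      unfolding eq[symmetric] by (simp add: image_image)
    also have "\<dots> = U"
    proof (intro subset_antisym subsetI)
      show "x \<in> U" if "x \<in> scale c ` U" for x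
        using that subspace_scale[OF U] by blast
      show "x \<in> scale c ` U" if "x \<in> U" for x
        using subspace_scale[OF U that, of "inverse c"] c(1)
        by (intro image_eqI[of _ _ "scale (inverse c) x"]) auto
    qed
    finally show ?thesis .
  qed
  show ?thesis
    by (rule that[of U a]) (fact U | fact \<open>U \<noteq> {0}\<close> | erule a(1) | erule surj)+
qed

text \<open>
  Induction on the number of terms, as for the independence of characters. Applying a relation to
  \<open>a i * v\<close> and moving \<open>a i\<close> to the front gives a relation whose coefficients are rescaled by
  \<open>inverse (\<theta> i t)\<close>; subtracting a multiple of the original one removes the term \<open>l\<close>. An index \<open>i\<close>
  that keeps a given other term alive exists because columns with different indices differ.
\<close>

lemma homogeneous_elements_independent:
  assumes min: "minimal_decomposition m \<theta>"
    and a: "\<And>t. t \<in> {1..m} \<Longrightarrow> a t \<in> R t"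
    and V: "\<And>t v. t \<in> {1..m} \<Longrightarrow> v \<in> V \<Longrightarrow> a t * v \<in> V"
      "\<And>t v. t \<in> {1..m} \<Longrightarrow> v \<in> V \<Longrightarrow> a t * v = 0 \<Longrightarrow> v = 0" "subspace V" "V \<noteq> {0}"
    and T: "T \<subseteq> {1..m}" and 0: "\<And>v. v \<in> V \<Longrightarrow> (\<Sum>t\<in>T. scale (\<kappa> t) (a t * v)) = 0"
    and l: "l \<in> T"
  shows "\<kappa> l = 0"
proof -
  have fin: "finite T"
    using finite_subset[OF T] by simp
  have "\<forall>\<kappa>. (\<forall>v\<in>V. (\<Sum>t\<in>T. scale (\<kappa> t) (a t * v)) = 0) \<longrightarrow> (\<forall>l\<in>T. \<kappa> l = 0)"
    using fin T
  proof (induction T rule: finite_induct)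
    case (insert l T)
    show ?case
    proof (intro allI impI)
      fix \<kappa> assume rel: "\<forall>v\<in>V. (\<Sum>t\<in>insert l T. scale (\<kappa> t) (a t * v)) = 0"
      have "\<kappa> k = 0" if k: "k \<in> T" for k
      proof -
        have kl: "k \<in> {1..m}" "l \<in> {1..m}" "k \<noteq> l"
          using insert.hyps insert.prems k by auto
        then obtain i where i: "i \<in> {1..m}" "\<theta> i k \<noteq> \<theta> i l"
          using min unfolding minimal_decomposition_def by blast
        have nz: "\<theta> i t \<noteq> 0" if "t \<in> insert l T" for t
          using theta_nonzero[OF i(1)] that insert.prems by blast
        have comm: "a t * (a i * v) = scale (inverse (\<theta> i t)) (a i * (a t * v))" if "t \<in> insert l T" for t v
        proof -
          have "a i * a t = scale (\<theta> i t) (a t * a i)"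
            using i(1) that insert.prems by (intro quantum_commute a) auto
          then have "a t * a i = scale (inverse (\<theta> i t)) (a i * a t)"
            using nz[OF that] by simp
          then show ?thesis
            by (metis mult.assoc scale_mult_left)
        qed
        \<comment> \<open>\<open>\<mu> l = 0\<close>, so that the rescaled relation has one term less.\<close>
        define \<mu> where "\<mu> t = inverse (\<theta> i t) - inverse (\<theta> i l)" for t
        have "(\<Sum>t\<in>T. scale (\<kappa> t * \<mu> t) (a t * v)) = 0" if v: "v \<in> V" for v
        proof -
          have terms: "scale (\<kappa> t * inverse (\<theta> i t)) (a i * (a t * v)) = scale (\<kappa> t) (a t * (a i * v))"
            if "t \<in> insert l T" for t
            by (simp add: comm[OF that])
          have "(\<Sum>t\<in>insert l T. scale (\<kappa> t) (a t * (a i * v))) = 0"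
            using rel V(1)[OF i(1) v] by blast
          then have "a i * (\<Sum>t\<in>insert l T. scale (\<kappa> t * inverse (\<theta> i t)) (a t * v)) = 0"
            unfolding mult_sum_scale by (simp only: sum.cong[OF refl terms])
          moreover have "(\<Sum>t\<in>insert l T. scale (\<kappa> t * inverse (\<theta> i t)) (a t * v)) \<in> V"
            using insert.prems v by (intro subspace_sum subspace_scale V(1,3)) auto
          ultimately have 1: "(\<Sum>t\<in>insert l T. scale (\<kappa> t * inverse (\<theta> i t)) (a t * v)) = 0"
            using V(2)[OF i(1)] by blast
          have "(\<Sum>t\<in>insert l T. scale (\<kappa> t * \<mu> t) (a t * v)) =
              (\<Sum>t\<in>insert l T. scale (\<kappa> t * inverse (\<theta> i t)) (a t * v)) -
              scale (inverse (\<theta> i l)) (\<Sum>t\<in>insert l T. scale (\<kappa> t) (a t * v))"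
            unfolding scale_sum_right sum_subtractf[symmetric]
            by (intro sum.cong refl) (simp add: \<mu>_def algebra_simps scale_left_diff_distrib)
          also have "\<dots> = 0"
            using 1 rel v by simp
          finally show ?thesis
            using insert.hyps by (simp add: \<mu>_def)
        qed
        then have "\<kappa> k * \<mu> k = 0"
          using insert.IH insert.prems k by (auto dest!: spec[of _ "\<lambda>t. \<kappa> t * \<mu> t"])
        moreover have "\<mu> k \<noteq> 0"
          using i(2) by (simp add: \<mu>_def)
        ultimately show ?thesis by simp
      qed
      moreover have "\<kappa> l = 0"
      proof -
        obtain v where v: "v \<in> V" "v \<noteq> 0"
          using V(3,4) subspace_0 by blast
        have "scale (\<kappa> l) (a l * v) = 0"
          using bspec[OF rel v(1)] insert.hyps calculation by simp
        moreover have "a l * v \<noteq> 0"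
          using V(2)[of l v] v insert.prems by blast
        ultimately show ?thesis by simp
      qed
      ultimately show "\<forall>l\<in>insert l T. \<kappa> l = 0" by blast
    qed
  qed simp
  then show ?thesis using 0 l by blast
qed

text \<open>
  The \<open>m\<close> operators on \<open>V\<close> are independent elements of a space of dimension \<open>(dim V)\<^sup>2\<close>: otherwise their
  matrix coefficients would give a homogeneous system with more unknowns than equations.
\<close>

lemma large_irreducible_subspace:
  assumes min: "minimal_decomposition m \<theta>"
  obtains V where "irreducible_subspace V" "m \<le> (dim V)\<^sup>2"
proof -
  obtain U a where U: "subspace U" "U \<noteq> {0}"
    and a: "\<And>t. t \<in> {1..m} \<Longrightarrow> a t \<in> R t" and surj: "\<And>t. t \<in> {1..m} \<Longrightarrow> (*) (a t) ` U = U"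
    using bijective_homogeneous_elements by blast
  define inv where "inv W \<longleftrightarrow> subspace W \<and> W \<noteq> {0} \<and> W \<subseteq> U \<and> (\<forall>t\<in>{1..m}. \<forall>v\<in>W. a t * v \<in> W)" for W
  have "inv U"
    unfolding inv_def using U surj by blast
  then obtain V where V: "inv V" and least: "\<And>W. inv W \<Longrightarrow> dim V \<le> dim W"
    using ex_has_least_nat[of inv U dim] by blast
  have irr: "irreducible_subspace V"
    unfolding irreducible_subspace_def
  proof (intro conjI allI impI)
    fix W assume W: "subspace W" "W \<subseteq> V" "\<forall>r\<in>stabilizer V. \<forall>w\<in>W. r * w \<in> W"
    have "a t \<in> stabilizer V" if "t \<in> {1..m}" for t
      using V that by (auto simp: inv_def stabilizer_def)
    then have "W = {0} \<or> inv W"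
      using W V by (auto simp: inv_def)
    then show "W = {0} \<or> W = V"
      using subspace_dim_equal[OF W(1) _ W(2)] least V by (auto simp: inv_def)
  qed (use V in \<open>auto simp: inv_def\<close>)
  have V': "subspace V" "V \<noteq> {0}" "V \<subseteq> U" "\<And>t v. t \<in> {1..m} \<Longrightarrow> v \<in> V \<Longrightarrow> a t * v \<in> V"
    using V by (auto simp: inv_def)
  have inj: "v = 0" if "t \<in> {1..m}" "v \<in> V" "a t * v = 0" for t v
    using left_mult_surj_imp_inj[OF U(1) surj] that V'(3) by blast
  obtain C where C: "C \<subseteq> V" "independent C" "V \<subseteq> span C" "card C = dim V"
    using basis_exists by blast
  have fin: "finite C"
    using C(2) by (rule finiteI_independent)
  have "m \<le> card (C \<times> C)"
  proof (rule ccontr)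
    assume "\<not> ?thesis"
    then have "card (C \<times> C) < card {1..m}" by simp
    then obtain \<kappa> where \<kappa>: "\<exists>t\<in>{1..m}. \<kappa> t \<noteq> 0"
        "\<And>x y. x \<in> C \<Longrightarrow> y \<in> C \<Longrightarrow> (\<Sum>t\<in>{1..m}. \<kappa> t * representation C (a t * x) y) = 0"
      using homogeneous_system_nontrivial_solution[of "C \<times> C" "{1..m}" "\<lambda>(x, y) t. representation C (a t * x) y"]
        fin by fastforce
    have "(\<Sum>t\<in>{1..m}. scale (\<kappa> t) (a t * x)) = 0" if x: "x \<in> C" for x
    proof -
      have *: "a t * x = (\<Sum>y\<in>C. scale (representation C (a t * x) y) y)" if "t \<in> {1..m}" for t
        using V'(4)[OF that] x C sum_representation_eq[OF C(2) _ fin subset_refl] by (metis in_mono)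
      have "(\<Sum>t\<in>{1..m}. scale (\<kappa> t) (a t * x)) =
          (\<Sum>t\<in>{1..m}. \<Sum>y\<in>C. scale (\<kappa> t * representation C (a t * x) y) y)"
        by (rule sum.cong[OF refl]) (subst *, simp_all add: scale_sum_right)
      also have "\<dots> = (\<Sum>y\<in>C. \<Sum>t\<in>{1..m}. scale (\<kappa> t * representation C (a t * x) y) y)"
        by (rule sum.swap)
      also have "\<dots> = 0"
        by (rule sum.neutral) (metis \<kappa>(2) x scale_sum_left scale_zero_left)
      finally show ?thesis .
    qed
    then have vanish: "(\<Sum>t\<in>{1..m}. scale (\<kappa> t) (a t * v)) = 0" if "v \<in> V" for v
    proof -
      have "v \<in> span C" using that C(3) by blast
      then show ?thesis
      proof (induction rule: span_induct_alt)
        case (step c x y)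
        have "(\<Sum>t\<in>{1..m}. scale (\<kappa> t) (a t * (scale c x + y))) =
            scale c (\<Sum>t\<in>{1..m}. scale (\<kappa> t) (a t * x)) + (\<Sum>t\<in>{1..m}. scale (\<kappa> t) (a t * y))"
          unfolding scale_sum_right sum.distrib[symmetric]
          by (intro sum.cong refl)
            (simp add: distrib_left scale_right_distrib mult.commute flip: scale_mult_right)
        then show ?case
          using step \<open>\<And>x. x \<in> C \<Longrightarrow> (\<Sum>t\<in>{1..m}. scale (\<kappa> t) (a t * x)) = 0\<close> by simp
      qed simp
    qed
    have "\<kappa> l = 0" if "l \<in> {1..m}" for l
      by (rule homogeneous_elements_independent[where a = a and V = V and T = "{1..m}", OF min])
        (fact V'(1) | fact V'(2) | fact subset_refl | fact that | erule a | erule vanish |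
          erule (1) V'(4) | erule (2) inj)+
    then show False
      using \<kappa>(1) by blast
  qed
  then have "m \<le> (dim V)\<^sup>2"
    using C(4) fin by (simp add: card_cartesian_product power2_eq_square)
  then show ?thesis
    by (rule that[OF irr])
qed

end


section \<open>Burnside's theorem\<close>

context finite_dimensional_algebra
begin

lemma stabilizer_mult: "r \<in> stabilizer V \<Longrightarrow> s \<in> stabilizer V \<Longrightarrow> r * s \<in> stabilizer V"
  by (simp add: stabilizer_def mult.assoc)

lemma stabilizer_diff:
  "subspace V \<Longrightarrow> r \<in> stabilizer V \<Longrightarrow> s \<in> stabilizer V \<Longrightarrow> r - s \<in> stabilizer V"
  by (simp add: stabilizer_def left_diff_distrib subspace_diff)

lemma stabilizer_scale: "subspace V \<Longrightarrow> r \<in> stabilizer V \<Longrightarrow> scale c r \<in> stabilizer V"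
  by (simp add: stabilizer_def subspace_scale flip: scale_mult_left)

text \<open>
  The vectors reached from \<open>v\<close> form an invariant subspace, and it contains \<open>v\<close>.
\<close>

lemma irreducible_transitive:
  assumes V: "irreducible_subspace V" and v: "v \<in> V" "v \<noteq> 0" and w: "w \<in> V"
  shows "\<exists>r\<in>stabilizer V. r * v = w"
proof -
  define W where "W = (\<lambda>r. r * v) ` stabilizer V"
  have sub: "subspace V"
    using V by (simp add: irreducible_subspace_def)
  have "subspace W"
    unfolding subspace_def
  proof (intro conjI ballI allI)
    show "0 \<in> W"
      unfolding W_def by (rule image_eqI[of _ _ 0]) (simp_all add: stabilizer_def subspace_0[OF sub])
    fix x assume x: "x \<in> W"
    then obtain r where r: "r \<in> stabilizer V" "x = r * v"
      unfolding W_def by blast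
    show "x + y \<in> W" if y: "y \<in> W" for y
    proof -
      obtain s where "s \<in> stabilizer V" "y = s * v"
        using y unfolding W_def by blast
      then show ?thesis
        using r unfolding W_def
        by (intro image_eqI[of _ _ "r + s"]) (simp_all add: stabilizer_def distrib_right subspace_add[OF sub])
    qed
    show "scale c x \<in> W" for c
      using r stabilizer_scale[OF sub r(1)] unfolding W_def
      by (intro image_eqI[of _ _ "scale c r"]) (simp_all flip: scale_mult_left)
  qed
  moreover have "W \<subseteq> V"
    using v(1) by (auto simp: W_def stabilizer_def)
  moreover have "\<forall>r\<in>stabilizer V. \<forall>w\<in>W. r * w \<in> W"
    unfolding W_def by (auto simp: stabilizer_mult simp flip: mult.assoc)
  ultimately have "W = {0} \<or> W = V"
    using V by (simp add: irreducible_subspace_def)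
  moreover have "v \<in> W"
    unfolding W_def by (rule image_eqI[of _ _ 1]) (simp_all add: stabilizer_def)
  ultimately have "w \<in> W"
    using v(2) w by blast
  then show ?thesis
    unfolding W_def by blast
qed

text \<open>
  The vector \<open>p(r) y\<close>, for left multiplication by \<open>r\<close>.
\<close>

definition orbit_eval :: "'a \<Rightarrow> 'a \<Rightarrow> 'k poly \<Rightarrow> 'a" where
  "orbit_eval r y p = (\<Sum>k\<le>degree p. scale (coeff p k) (r ^ k * y))"

lemma orbit_eval_bound:
  assumes "degree p \<le> N"
  shows "orbit_eval r y p = (\<Sum>k\<le>N. scale (coeff p k) (r ^ k * y))"
  unfolding orbit_eval_def using assms
  by (intro sum.mono_neutral_left) (auto simp: coeff_eq_0)

lemma orbit_eval_linear_factor: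
  "orbit_eval r y ([:- c, 1:] * q) = r * orbit_eval r y q - scale c (orbit_eval r y q)"
proof -
  let ?N = "Suc (degree q)"
  have "degree ([:- c, 1:] * q) \<le> ?N"
    using degree_mult_le[of "[:- c, 1:]" q] by simp
  then have "orbit_eval r y ([:- c, 1:] * q) =
      (\<Sum>k\<le>?N. scale (coeff (pCons 0 q) k) (r ^ k * y)) - (\<Sum>k\<le>?N. scale (c * coeff q k) (r ^ k * y))"
    by (subst orbit_eval_bound[of _ ?N])
      (simp_all add: scale_left_diff_distrib flip: sum_subtractf)
  also have "(\<Sum>k\<le>?N. scale (coeff (pCons 0 q) k) (r ^ k * y)) = r * orbit_eval r y q"
    unfolding sum.atMost_Suc_shift orbit_eval_def
    by (simp add: sum_distrib_left mult.assoc flip: scale_mult_right)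
  also have "(\<Sum>k\<le>?N. scale (c * coeff q k) (r ^ k * y)) = scale c (orbit_eval r y q)"
    by (subst orbit_eval_bound[of _ ?N]) (simp_all add: scale_sum_right scale_right_distrib)
  finally show ?thesis .
qed

lemma orbit_relation_exists: "\<exists>p. p \<noteq> 0 \<and> orbit_eval r y p = 0"
proof -
  let ?N = "card Basis"
  obtain c where c: "\<exists>k\<in>{..?N}. c k \<noteq> 0"
      "\<And>b. b \<in> Basis \<Longrightarrow> (\<Sum>k\<le>?N. c k * representation Basis (r ^ k * y) b) = 0"
    using homogeneous_system_nontrivial_solution[OF finite_Basis,
        of "{..?N}" "\<lambda>b k. representation Basis (r ^ k * y) b"] by auto
  define p where "p = (\<Sum>k\<le>?N. monom (c k) k)"
  have coeff: "coeff p k = (if k \<le> ?N then c k else 0)" for k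
    by (simp add: p_def coeff_sum when_def)
  have "p \<noteq> 0"
    using c(1) coeff by (metis atMost_iff coeff_0)
  moreover have "orbit_eval r y p = 0"
  proof -
    have "degree p \<le> ?N"
      by (rule degree_le) (simp add: coeff)
    then have "orbit_eval r y p = (\<Sum>k\<le>?N. scale (c k) (r ^ k * y))"
      by (subst orbit_eval_bound[of _ ?N]) (simp_all add: coeff)
    also have "\<dots> = (\<Sum>k\<le>?N. \<Sum>b\<in>Basis. scale (c k * representation Basis (r ^ k * y) b) b)"
    proof (rule sum.cong[OF refl])
      fix k
      have "r ^ k * y = (\<Sum>b\<in>Basis. scale (representation Basis (r ^ k * y) b) b)"
        by (rule sum_representation_eq[symmetric, OF independent_Basis _ finite_Basis subset_refl])
          (simp add: span_Basis)
      then have "scale (c k) (r ^ k * y) =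
          scale (c k) (\<Sum>b\<in>Basis. scale (representation Basis (r ^ k * y) b) b)"
        by (rule arg_cong)
      then show "scale (c k) (r ^ k * y) = (\<Sum>b\<in>Basis. scale (c k * representation Basis (r ^ k * y) b) b)"
        by (simp add: scale_sum_right)
    qed
    also have "\<dots> = (\<Sum>b\<in>Basis. scale (\<Sum>k\<le>?N. c k * representation Basis (r ^ k * y) b) b)"
      by (subst sum.swap) (simp add: scale_sum_left)
    also have "\<dots> = 0"
      using c(2) by simp
    finally show ?thesis .
  qed
  ultimately show ?thesis by blast
qed

end

locale closed_finite_dimensional_algebra = finite_dimensional_algebra scale Basis
  for scale :: "'k::alg_closed_field \<Rightarrow> 'a::ring_1 \<Rightarrow> 'a" and Basis
begin

text \<open>
  Take \<open>p \<noteq> 0\<close> of minimal degree with \<open>p(r) y = 0\<close> and split off a linear factor \<open>X - c\<close>. The cofactor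
  \<open>q\<close> has \<open>q(r) y \<noteq> 0\<close> by minimality, and this is an eigenvector for \<open>c\<close>.
\<close>

lemma eigenvector_exists:
  assumes Y: "subspace Y" "Y \<noteq> {0}" and r: "\<And>y. y \<in> Y \<Longrightarrow> r * y \<in> Y"
  obtains c y where "y \<in> Y" "y \<noteq> 0" "r * y = scale c y"
proof -
  obtain y where y: "y \<in> Y" "y \<noteq> 0"
    using Y subspace_0 by blast
  obtain p where p: "p \<noteq> 0" "orbit_eval r y p = 0"
    and least: "\<And>q. q \<noteq> 0 \<Longrightarrow> orbit_eval r y q = 0 \<Longrightarrow> degree p \<le> degree q"
    using ex_has_least_nat[of "\<lambda>p. p \<noteq> 0 \<and> orbit_eval r y p = 0" _ degree] orbit_relation_exists
    by (metis (no_types, lifting))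
  have "degree p > 0"
  proof (rule ccontr)
    assume "\<not> degree p > 0"
    then obtain a where "p = [:a:]"
      by (auto elim: degree_eq_zeroE)
    with p y(2) show False
      by (simp add: orbit_eval_def)
  qed
  then obtain c where "poly p c = 0"
    using alg_closed_imp_poly_has_root by blast
  then obtain q where q: "p = [:- c, 1:] * q"
    by (metis dvdE poly_eq_0_iff_dvd)
  with p(1) have "q \<noteq> 0" by auto
  then have "degree p = Suc (degree q)"
    unfolding q by (subst degree_mult_eq) auto
  then have "orbit_eval r y q \<noteq> 0"
    using least[OF \<open>q \<noteq> 0\<close>] by auto
  moreover have "orbit_eval r y q \<in> Y"
  proof -
    have "r ^ k * y \<in> Y" for k
      by (induction k) (use y(1) r in \<open>auto simp: mult.assoc\<close>)
    then show ?thesis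
      unfolding orbit_eval_def by (intro subspace_sum subspace_scale Y(1))
  qed
  moreover have "r * orbit_eval r y q = scale c (orbit_eval r y q)"
    using p(2) unfolding q orbit_eval_linear_factor by simp
  ultimately show ?thesis
    using that by blast
qed

text \<open>
  Take \<open>T\<close> of minimal positive rank on \<open>V\<close>. If \<open>T x\<close> and \<open>T y\<close> were independent, choose \<open>S\<close> with
  \<open>S T x = y\<close> and an eigenvalue \<open>c\<close> of \<open>T S\<close> on the image of \<open>T\<close>. Then \<open>(T S - c) T\<close> is nonzero, since
  it maps \<open>x\<close> to \<open>T y - c T x\<close>, but has smaller rank than \<open>T\<close>.
\<close>

lemma rank_one_element_exists:
  assumes V: "irreducible_subspace V"
  obtains T t \<phi> where "T \<in> stabilizer V" "t \<noteq> 0" "\<And>v. v \<in> V \<Longrightarrow> T * v = scale (\<phi> v) t"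
    "\<exists>v\<in>V. T * v \<noteq> 0"
proof -
  have sub: "subspace V" and nz: "V \<noteq> {0}"
    using V by (auto simp: irreducible_subspace_def)
  define acts where "acts T \<longleftrightarrow> T \<in> stabilizer V \<and> (\<exists>v\<in>V. T * v \<noteq> 0)" for T
  have "acts 1"
    using nz subspace_0[OF sub] by (auto simp: acts_def stabilizer_def)
  then obtain T where T: "acts T" and least: "\<And>S. acts S \<Longrightarrow> dim ((*) T ` V) \<le> dim ((*) S ` V)"
    using ex_has_least_nat[of acts 1 "\<lambda>T. dim ((*) T ` V)"] by blast
  have Tstab: "T \<in> stabilizer V"
    using T by (simp add: acts_def)
  obtain x where x: "x \<in> V" "T * x \<noteq> 0"
    using T by (auto simp: acts_def)
  have "\<exists>c. T * y = scale c (T * x)" if y: "y \<in> V" for y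
  proof (rule ccontr)
    assume indep: "\<nexists>c. T * y = scale c (T * x)"
    have "T * x \<in> V"
      using x(1) Tstab by (simp add: stabilizer_def)
    then obtain S where S: "S \<in> stabilizer V" "S * (T * x) = y"
      using irreducible_transitive[OF V _ x(2) y] by blast
    define W where "W = (*) T ` V"
    have W: "subspace W" "W \<subseteq> V"
      using subspace_left_multiples[OF sub] Tstab by (auto simp: W_def stabilizer_def)
    have "T * x \<in> W"
      using x(1) by (simp add: W_def)
    then have "W \<noteq> {0}"
      using x(2) by blast
    have TS: "T * S * w \<in> W" if "w \<in> W" for w
      using that W(2) S(1) by (auto simp: W_def stabilizer_def mult.assoc)
    obtain c u where u: "u \<in> W" "u \<noteq> 0" "T * S * u = scale c u"
      using eigenvector_exists[OF W(1) \<open>W \<noteq> {0}\<close> TS] by blast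
    define r where "r = T * S - scale c 1"
    have r: "r * w = T * S * w - scale c w" for w
      by (simp add: r_def left_diff_distrib flip: scale_mult_left)
    have "1 \<in> stabilizer V"
      by (simp add: stabilizer_def)
    then have "r \<in> stabilizer V"
      unfolding r_def by (intro stabilizer_diff stabilizer_mult stabilizer_scale sub Tstab S(1))
    moreover have "r * (T * x) = T * y - scale c (T * x)"
      unfolding r mult.assoc S(2) ..
    then have "r * T * x \<noteq> 0"
      using indep by (simp add: mult.assoc)
    ultimately have "acts (r * T)"
      using x(1) Tstab by (auto simp: acts_def stabilizer_mult)
    then have "dim W \<le> dim ((*) (r * T) ` V)"
      using least by (simp add: W_def)
    also have "(*) (r * T) ` V = (*) r ` W"
      by (simp add: W_def image_image mult.assoc)
    finally have "dim W \<le> dim ((*) r ` W)" .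
    moreover have "(*) r ` W \<subseteq> W"
      using TS by (auto simp: r intro!: subspace_diff subspace_scale W(1))
    ultimately have "(*) r ` W = W"
      using subspace_dim_equal[OF subspace_left_multiples[OF W(1)] W(1)] by blast
    moreover have "r * u = 0"
      using u(3) by (simp add: r)
    ultimately have "u = 0"
      using left_mult_surj_imp_inj[OF W(1) _ u(1)] by blast
    with u(2) show False by blast
  qed
  then obtain \<phi> where "\<And>y. y \<in> V \<Longrightarrow> T * y = scale (\<phi> y) (T * x)"
    by metis
  then show ?thesis
    using that[OF Tstab x(2)] x by blast
qed

text \<open>
  This is the induction of the density theorem. Let \<open>x0\<close> be a new vector outside \<open>span X\<close>, and consider the
  elements \<open>S\<close> for which \<open>T S\<close> kills \<open>X\<close>. If \<open>T S x0 = 0\<close> always implied \<open>T S v = 0\<close>, then \<open>T S v\<close>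
  would be a constant multiple \<open>\<nu>\<close> of \<open>T S x0\<close>, because \<open>T\<close> has rank one. Hence \<open>T S\<close> would kill
  \<open>v - \<nu> x0\<close> for all such \<open>S\<close>, and by the induction hypothesis \<open>v - \<nu> x0\<close> would lie in \<open>span X\<close>.
\<close>

lemma separate_from_span:
  assumes V: "irreducible_subspace V" and T: "T \<in> stabilizer V" "t \<noteq> 0"
    "\<And>v. v \<in> V \<Longrightarrow> T * v = scale (\<phi> v) t" "\<exists>v\<in>V. T * v \<noteq> 0"
    and X: "finite X" "X \<subseteq> V" and v: "v \<in> V" "v \<notin> span X"
  shows "\<exists>S\<in>stabilizer V. (\<forall>x\<in>X. T * (S * x) = 0) \<and> T * (S * v) \<noteq> 0"
  using X v
proof (induction X arbitrary: v rule: finite_induct)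
  case empty
  then have "v \<noteq> 0" by simp
  obtain w where w: "w \<in> V" "T * w \<noteq> 0"
    using T(4) by blast
  obtain S where "S \<in> stabilizer V" "S * v = w"
    using irreducible_transitive[OF V empty.prems(2) \<open>v \<noteq> 0\<close> w(1)] by blast
  then show ?case
    using w(2) by auto
next
  case (insert x0 X)
  have sub: "subspace V"
    using V by (simp add: irreducible_subspace_def)
  have x0: "x0 \<in> V" and X: "X \<subseteq> V"
    using insert.prems by auto
  have g: "T * (S * x) = scale (\<phi> (S * x)) t" if "S \<in> stabilizer V" "x \<in> V" for S x
    using that by (intro T(3)) (simp add: stabilizer_def)
  show ?case
  proof (cases "x0 \<in> span X")
    case True
    have "v \<notin> span X"
      using insert.prems(3) span_mono[of X "insert x0 X"] by blast
    then obtain S where S: "S \<in> stabilizer V" "\<forall>x\<in>X. T * (S * x) = 0" "T * (S * v) \<noteq> 0"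
      using insert.IH[OF X insert.prems(2)] by blast
    have "T * (S * x0) = 0"
      using True
    proof (induction rule: span_induct_alt)
      case (step c x y)
      have "T * (S * (scale c x + y)) = scale c (T * (S * x)) + T * (S * y)"
        by (simp add: distrib_left flip: scale_mult_right)
      then show ?case
        using step S(2) by simp
    qed simp
    with S show ?thesis by blast
  next
    case False
    then obtain S0 where S0: "S0 \<in> stabilizer V" "\<forall>x\<in>X. T * (S0 * x) = 0" "T * (S0 * x0) \<noteq> 0"
      using insert.IH[OF X x0] by blast
    then have nz: "\<phi> (S0 * x0) \<noteq> 0"
      using g[OF S0(1) x0] by auto
    show ?thesis
    proof (rule ccontr)
      assume *: "\<not> ?thesis"
      define \<nu> where "\<nu> = \<phi> (S0 * v) / \<phi> (S0 * x0)"
      have "v - scale \<nu> x0 \<notin> span X"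
      proof
        assume "v - scale \<nu> x0 \<in> span X"
        then have "v \<in> span (insert x0 X)"
          unfolding span_insert by blast
        with insert.prems(3) show False by blast
      qed
      moreover have "v - scale \<nu> x0 \<in> V"
        by (intro subspace_diff subspace_scale sub insert.prems(2) x0)
      ultimately obtain S where S: "S \<in> stabilizer V" "\<forall>x\<in>X. T * (S * x) = 0" "T * (S * (v - scale \<nu> x0)) \<noteq> 0"
        using insert.IH[OF X] by blast
      \<comment> \<open>With this \<open>\<mu>\<close> the element \<open>S - \<mu> S0\<close> also kills \<open>x0\<close> after applying \<open>T\<close>.\<close>
      define \<mu> where "\<mu> = \<phi> (S * x0) / \<phi> (S0 * x0)"
      define S1 where "S1 = S - scale \<mu> S0"
      have S1: "T * (S1 * x) = T * (S * x) - scale \<mu> (T * (S0 * x))" for x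
        by (simp add: S1_def left_diff_distrib right_diff_distrib flip: scale_mult_left scale_mult_right)
      have "S1 \<in> stabilizer V"
        unfolding S1_def by (intro stabilizer_diff stabilizer_scale sub S(1) S0(1))
      moreover have "T * (S1 * x0) = 0"
        using nz by (simp add: S1 g[OF S(1) x0] g[OF S0(1) x0] \<mu>_def)
      moreover have "\<forall>x\<in>X. T * (S1 * x) = 0"
        using S(2) S0(2) by (simp add: S1)
      ultimately have "T * (S1 * v) = 0"
        using * by blast
      then have "scale (\<phi> (S * v) - \<mu> * \<phi> (S0 * v)) t = 0"
        by (simp add: S1 g[OF S(1) insert.prems(2)] g[OF S0(1) insert.prems(2)] scale_left_diff_distrib)
      then have eq: "\<phi> (S * v) = \<mu> * \<phi> (S0 * v)"
        using T(2) by simp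
      have "T * (S * (v - scale \<nu> x0)) = T * (S * v) - scale \<nu> (T * (S * x0))"
        by (simp add: right_diff_distrib flip: scale_mult_right)
      also have "\<dots> = scale (\<phi> (S * v) - \<nu> * \<phi> (S * x0)) t"
        by (simp add: g[OF S(1) insert.prems(2)] g[OF S(1) x0] scale_left_diff_distrib)
      also have "\<phi> (S * v) - \<nu> * \<phi> (S * x0) = 0"
        unfolding eq by (simp add: \<mu>_def \<nu>_def)
      finally show False
        using S(3) by simp
    qed
  qed
qed

text \<open>
  A rank one element that vanishes on all basis vectors except \<open>c\<close> is followed by an element that moves the
  image of \<open>c\<close> to \<open>b\<close>.
\<close>

theorem burnside_matrix_units:
  assumes V: "irreducible_subspace V" and C: "C \<subseteq> V" "independent C" and c: "c \<in> C" and b: "b \<in> V"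
  shows "\<exists>r. r * c = b \<and> (\<forall>x\<in>C - {c}. r * x = 0)"
proof -
  obtain T t \<phi> where T: "T \<in> stabilizer V" "t \<noteq> 0" "\<And>v. v \<in> V \<Longrightarrow> T * v = scale (\<phi> v) t" "\<exists>v\<in>V. T * v \<noteq> 0"
    using rank_one_element_exists[OF V] by blast
  have "finite (C - {c})"
    using finiteI_independent[OF C(2)] by simp
  moreover have "c \<notin> span (C - {c})"
    using C(2) c unfolding dependent_def by blast
  ultimately obtain S where S: "S \<in> stabilizer V" "\<forall>x\<in>C - {c}. T * (S * x) = 0" "T * (S * c) \<noteq> 0"
    using separate_from_span[OF V T, of "C - {c}" c] C(1) c by blast
  have "T * (S * c) \<in> V"
    using S(1) T(1) C(1) c by (auto simp: stabilizer_def)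
  then obtain r where "r * (T * (S * c)) = b"
    using irreducible_transitive[OF V _ S(3) b] by blast
  then show ?thesis
    using S(2) by (intro exI[of _ "r * T * S"]) (simp add: mult.assoc)
qed

end


section \<open>The rank of a family of vectors and its Gram matrix\<close>

definition dot :: "'j set \<Rightarrow> ('j \<Rightarrow> real) \<Rightarrow> ('j \<Rightarrow> real) \<Rightarrow> real" where
  "dot J x y = (\<Sum>j\<in>J. x j * y j)"

lemma dot_commute: "dot J x y = dot J y x"
  by (simp add: dot_def mult.commute)

lemma dot_cong: "(\<And>j. j \<in> J \<Longrightarrow> x j = x' j) \<Longrightarrow> dot J x y = dot J x' y"
  by (simp add: dot_def)

lemma dot_sum_left: "dot J (\<lambda>j. \<Sum>f\<in>F. c f * x f j) y = (\<Sum>f\<in>F. c f * dot J (x f) y)"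
  unfolding dot_def sum_distrib_left sum_distrib_right
  by (subst sum.swap) (simp add: mult.assoc)

lemma dot_diff_left: "dot J (\<lambda>j. x j - x' j) y = dot J x y - dot J x' y"
  by (simp add: dot_def left_diff_distrib sum_subtractf)

lemma dot_divide_right: "dot J x (\<lambda>j. y j / s) = dot J x y / s"
  by (simp add: dot_def sum_divide_distrib)

lemma dot_divide_left: "dot J (\<lambda>j. x j / s) y = dot J x y / s"
  by (simp add: dot_def sum_divide_distrib)

text \<open>
  The orthonormal system is indexed by the selected subfamily \<open>F\<close> itself, so that \<open>card F\<close> is both the
  number of independent vectors and the number of coordinates used in \<open>rank_ge_trace_squared\<close>.
\<close>

lemma gram_schmidt:
  fixes v :: "'i \<Rightarrow> 'j \<Rightarrow> real"
  assumes "finite I" "finite J"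
  shows "\<exists>F u. F \<subseteq> I \<and>
    (\<forall>c. (\<forall>j\<in>J. (\<Sum>i\<in>F. c i * v i j) = 0) \<longrightarrow> (\<forall>i\<in>F. c i = 0)) \<and>
    (\<forall>f\<in>F. \<forall>g\<in>F. dot J (u f) (u g) = (if f = g then 1 else 0)) \<and>
    (\<forall>i\<in>I. \<forall>j\<in>J. v i j = (\<Sum>f\<in>F. dot J (v i) (u f) * u f j))"
  using assms(1)
proof (induction I rule: finite_induct)
  case empty
  show ?case by (intro exI[of _ "{}"]) simp
next
  case (insert a I)
  obtain F u where F: "F \<subseteq> I"
    and indep': "\<forall>c. (\<forall>j\<in>J. (\<Sum>i\<in>F. c i * v i j) = 0) \<longrightarrow> (\<forall>i\<in>F. c i = 0)"
    and orth': "\<forall>f\<in>F. \<forall>g\<in>F. dot J (u f) (u g) = (if f = g then 1 else 0)"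
    and expand': "\<forall>i\<in>I. \<forall>j\<in>J. v i j = (\<Sum>f\<in>F. dot J (v i) (u f) * u f j)"
    using insert.IH by (elim exE conjE)
  have indep: "\<And>c. (\<forall>j\<in>J. (\<Sum>i\<in>F. c i * v i j) = 0) \<Longrightarrow> \<forall>i\<in>F. c i = 0"
    using indep' by (elim allE) (rule mp)
  have orth: "\<And>f g. f \<in> F \<Longrightarrow> g \<in> F \<Longrightarrow> dot J (u f) (u g) = (if f = g then 1 else 0)"
    by (rule orth'[rule_format])
  have expand: "\<And>i j. i \<in> I \<Longrightarrow> j \<in> J \<Longrightarrow> v i j = (\<Sum>f\<in>F. dot J (v i) (u f) * u f j)"
    by (rule expand'[rule_format])
  have fin: "finite F" and aF: "a \<notin> F"
    using F insert.hyps finite_subset by auto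
  define w where "w j = v a j - (\<Sum>f\<in>F. dot J (v a) (u f) * u f j)" for j
  have dot_w: "dot J w y = dot J (v a) y - (\<Sum>f\<in>F. dot J (v a) (u f) * dot J (u f) y)" for y
    unfolding w_def by (simp add: dot_diff_left dot_sum_left)
  have w_u: "dot J w (u g) = 0" if g: "g \<in> F" for g
  proof -
    note dot_w[of "u g"]
    also have "(\<Sum>f\<in>F. dot J (v a) (u f) * dot J (u f) (u g)) = (\<Sum>f\<in>F. if f = g then dot J (v a) (u g) else 0)"
      by (intro sum.cong refl) (simp add: orth g)
    also have "\<dots> = dot J (v a) (u g)"
      using fin g by simp
    finally show ?thesis by simp
  qed
  have v_w: "dot J (v i) w = 0" if i: "i \<in> I" for i
  proof -
    have "dot J (v i) w = dot J (\<lambda>j. \<Sum>f\<in>F. dot J (v i) (u f) * u f j) w"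
      using expand[OF i] by (intro dot_cong)
    also have "\<dots> = 0"
      unfolding dot_sum_left by (intro sum.neutral ballI) (simp add: dot_commute[of J _ w] w_u)
    finally show ?thesis .
  qed
  have va_w: "dot J (v a) w = dot J w w"
  proof -
    note dot_w[of w]
    also have "(\<Sum>f\<in>F. dot J (v a) (u f) * dot J (u f) w) = 0"
      by (intro sum.neutral ballI) (simp add: dot_commute[of J _ w] w_u)
    finally show ?thesis by simp
  qed
  show ?case
  proof (cases "dot J w w = 0")
    case True
    have "w j = 0" if "j \<in> J" for j
      using True that sum_nonneg_eq_0_iff[OF assms(2), of "\<lambda>j. w j * w j"] by (simp add: dot_def)
    then have "v a j = (\<Sum>f\<in>F. dot J (v a) (u f) * u f j)" if "j \<in> J" for j
      using that by (simp add: w_def)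
    then show ?thesis
      using F indep orth expand by (intro exI[of _ F] exI[of _ u] conjI) auto
  next
    case False
    have "dot J w w \<ge> 0"
      by (auto simp: dot_def intro!: sum_nonneg)
    define s where "s = sqrt (dot J w w)"
    have s: "s \<noteq> 0" "s * s = dot J w w"
      using False \<open>dot J w w \<ge> 0\<close> by (simp_all add: s_def)
    define u' where "u' = u(a := (\<lambda>j. w j / s))"
    have u'F: "u' f = u f" if "f \<in> F" for f
      using that aF by (auto simp: u'_def)
    have u'a: "u' a = (\<lambda>j. w j / s)"
      by (simp add: u'_def)
    have split: "(\<Sum>f\<in>insert a F. dot J x (u' f) * u' f j) =
        dot J x w / s * (w j / s) + (\<Sum>f\<in>F. dot J x (u f) * u f j)" for x j
      using fin aF by (simp add: u'a u'F dot_divide_right)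
    show ?thesis
    proof (intro exI[of _ "insert a F"] exI[of _ u'] conjI allI impI ballI)
      show "insert a F \<subseteq> insert a I" using F by blast
    next
      fix c i assume rel: "\<forall>j\<in>J. (\<Sum>i\<in>insert a F. c i * v i j) = 0" and i: "i \<in> insert a F"
      have "0 = dot J (\<lambda>j. \<Sum>i\<in>insert a F. c i * v i j) w"
        using rel by (simp add: dot_def)
      also have "\<dots> = (\<Sum>i\<in>insert a F. c i * dot J (v i) w)"
        by (rule dot_sum_left)
      also have "\<dots> = c a * dot J w w"
        using fin aF F by (simp add: va_w subset_iff v_w)
      finally have "c a = 0"
        using False by simp
      then have "\<forall>i\<in>F. c i = 0"
        using rel fin aF by (intro indep) simp
      with \<open>c a = 0\<close> i show "c i = 0" by blast
    next
      fix f g assume "f \<in> insert a F" "g \<in> insert a F"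
      moreover have "dot J (u' a) (u' a) = 1"
        using s by (simp add: u'a dot_divide_left dot_divide_right flip: s(2))
      moreover have "dot J (u' a) (u' f) = 0" "dot J (u' f) (u' a) = 0" if "f \<in> F" for f
        using that w_u dot_commute[of J "u f" w] by (simp_all add: u'a u'F dot_divide_left dot_divide_right)
      ultimately show "dot J (u' f) (u' g) = (if f = g then 1 else 0)"
        using orth aF by (auto simp: u'F)
    next
      fix i j assume i: "i \<in> insert a I" and j: "j \<in> J"
      show "v i j = (\<Sum>f\<in>insert a F. dot J (v i) (u' f) * u' f j)"
      proof (cases "i = a")
        case True
        have "dot J (v a) w / s * (w j / s) = w j"
          using s(1) by (simp add: va_w flip: s(2))
        then show ?thesis
          unfolding split True by (simp add: w_def)
      next
        case False
        then have "i \<in> I" using i by blast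
        then show ?thesis
          unfolding split using v_w expand[OF _ j] by simp
      qed
    qed
  qed
qed

lemma sum_squared_le_card:
  fixes s :: "'i \<Rightarrow> real"
  shows "(\<Sum>f\<in>F. s f)\<^sup>2 \<le> real (card F) * (\<Sum>f\<in>F. (s f)\<^sup>2)"
  using sum_squared_le_sum_of_squares[of s F] by (simp add: mult.commute)

text \<open>
  In an orthonormal basis of the span, \<open>s f g\<close> below is a square matrix of size \<open>card F\<close> with the same
  trace as the Gram matrix and the same sum of squared entries. The claim is the Cauchy-Schwarz inequality
  for its diagonal.
\<close>

lemma rank_ge_trace_squared:
  fixes v :: "'i \<Rightarrow> 'j \<Rightarrow> real"
  assumes "finite I" "finite J"
  obtains F where "F \<subseteq> I" "\<And>c. (\<forall>j\<in>J. (\<Sum>i\<in>F. c i * v i j) = 0) \<Longrightarrow> \<forall>i\<in>F. c i = 0"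
    "(\<Sum>i\<in>I. dot J (v i) (v i))\<^sup>2 \<le> real (card F) * (\<Sum>i\<in>I. \<Sum>k\<in>I. (dot J (v i) (v k))\<^sup>2)"
proof -
  obtain F u where F: "F \<subseteq> I"
    and indep': "\<forall>c. (\<forall>j\<in>J. (\<Sum>i\<in>F. c i * v i j) = 0) \<longrightarrow> (\<forall>i\<in>F. c i = 0)"
    and orth': "\<forall>f\<in>F. \<forall>g\<in>F. dot J (u f) (u g) = (if f = g then 1 else 0)"
    and expand': "\<forall>i\<in>I. \<forall>j\<in>J. v i j = (\<Sum>f\<in>F. dot J (v i) (u f) * u f j)"
    using gram_schmidt[OF assms, of v] by (elim exE conjE)
  have indep: "\<And>c. (\<forall>j\<in>J. (\<Sum>i\<in>F. c i * v i j) = 0) \<Longrightarrow> \<forall>i\<in>F. c i = 0"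
    using indep' by (elim allE) (rule mp)
  have orth: "\<And>f g. f \<in> F \<Longrightarrow> g \<in> F \<Longrightarrow> dot J (u f) (u g) = (if f = g then 1 else 0)"
    by (rule orth'[rule_format])
  have expand: "\<And>i j. i \<in> I \<Longrightarrow> j \<in> J \<Longrightarrow> v i j = (\<Sum>f\<in>F. dot J (v i) (u f) * u f j)"
    by (rule expand'[rule_format])
  define x where "x i f = dot J (v i) (u f)" for i f
  have dot_v: "dot J (v i) (v k) = (\<Sum>f\<in>F. x i f * x k f)" if "i \<in> I" for i k
  proof -
    have "dot J (v i) (v k) = dot J (\<lambda>j. \<Sum>f\<in>F. x i f * u f j) (v k)"
      using expand[OF that] by (intro dot_cong) (simp add: x_def)
    then show ?thesis
      by (simp add: dot_sum_left x_def dot_commute[of J "v k"])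
  qed
  define s where "s f g = (\<Sum>i\<in>I. x i f * x i g)" for f g
  have "(\<Sum>i\<in>I. dot J (v i) (v i)) = (\<Sum>f\<in>F. s f f)"
    unfolding s_def by (subst sum.swap) (simp add: dot_v)
  then have trace: "(\<Sum>i\<in>I. dot J (v i) (v i))\<^sup>2 \<le> real (card F) * (\<Sum>f\<in>F. (s f f)\<^sup>2)"
    using sum_squared_le_card[of "\<lambda>f. s f f" F] by simp
  have "(\<Sum>f\<in>F. (s f f)\<^sup>2) \<le> (\<Sum>f\<in>F. \<Sum>g\<in>F. (s f g)\<^sup>2)"
    using finite_subset[OF F assms(1)] by (intro sum_mono member_le_sum) auto
  also have "\<dots> = (\<Sum>f\<in>F. \<Sum>g\<in>F. \<Sum>i\<in>I. \<Sum>k\<in>I. x i f * x i g * (x k f * x k g))"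
    by (simp add: s_def power2_eq_square sum_product)
  also have "\<dots> = (\<Sum>f\<in>F. \<Sum>i\<in>I. \<Sum>g\<in>F. \<Sum>k\<in>I. x i f * x i g * (x k f * x k g))"
    by (rule sum.cong[OF refl], rule sum.swap)
  also have "\<dots> = (\<Sum>i\<in>I. \<Sum>f\<in>F. \<Sum>g\<in>F. \<Sum>k\<in>I. x i f * x i g * (x k f * x k g))"
    by (rule sum.swap)
  also have "\<dots> = (\<Sum>i\<in>I. \<Sum>f\<in>F. \<Sum>k\<in>I. \<Sum>g\<in>F. x i f * x i g * (x k f * x k g))"
    by (rule sum.cong[OF refl], rule sum.cong[OF refl], rule sum.swap)
  also have "\<dots> = (\<Sum>i\<in>I. \<Sum>k\<in>I. \<Sum>f\<in>F. \<Sum>g\<in>F. x i f * x i g * (x k f * x k g))"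
    by (rule sum.cong[OF refl], rule sum.swap)
  also have "\<dots> = (\<Sum>i\<in>I. \<Sum>k\<in>I. (dot J (v i) (v k))\<^sup>2)"
    by (rule sum.cong[OF refl], rule sum.cong[OF refl])
      (simp add: dot_v power2_eq_square sum_product mult_ac)
  finally have "real (card F) * (\<Sum>f\<in>F. (s f f)\<^sup>2) \<le>
      real (card F) * (\<Sum>i\<in>I. \<Sum>k\<in>I. (dot J (v i) (v k))\<^sup>2)"
    by (rule mult_left_mono) simp
  with trace show ?thesis
    by (intro that[OF F indep]) (assumption | rule order_trans)+
qed

text \<open>
  Given a relation over \<open>'k\<close> with \<open>c i \<noteq> 0\<close>, regard \<open>'k\<close> as a vector space over its prime field. A
  rational functional \<open>\<phi>\<close> with \<open>\<phi> (c i) = 1\<close> turns the relation into a nontrivial rational one, which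
  is in particular a real one.
\<close>

lemma natural_vectors_independent_transfer:
  fixes v :: "'i \<Rightarrow> 'j \<Rightarrow> nat" and c :: "'i \<Rightarrow> 'k::field_char_0"
  assumes indep: "\<And>c :: 'i \<Rightarrow> real. (\<forall>j\<in>J. (\<Sum>i\<in>F. c i * real (v i j)) = 0) \<Longrightarrow> \<forall>i\<in>F. c i = 0"
    and rel: "\<And>j. j \<in> J \<Longrightarrow> (\<Sum>i\<in>F. c i * of_nat (v i j)) = 0"
    and i: "i \<in> F"
  shows "c i = 0"
proof (rule ccontr)
  assume nz: "c i \<noteq> 0"
  interpret Q: vector_space "\<lambda>(q::rat) (x::'k). of_rat q * x"
    by standard (simp_all add: of_rat_add of_rat_mult algebra_simps)
  have "Q.independent {c i}"
    using nz by simp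
  define B where "B = Q.extend_basis {c i}"
  have B: "Q.independent B" "c i \<in> B" "Q.span B = UNIV"
    unfolding B_def
    using Q.independent_extend_basis[OF \<open>Q.independent {c i}\<close>] Q.extend_basis_superset[OF \<open>Q.independent {c i}\<close>]
      Q.span_extend_basis[OF \<open>Q.independent {c i}\<close>]
    by blast+
  define \<phi> where "\<phi> x = Q.representation B x (c i)" for x
  have \<phi>_scale: "\<phi> (x * of_nat n) = \<phi> x * of_nat n" for x n
    using Q.representation_scale[OF B(1), of x "of_nat n"] B(3) by (simp add: \<phi>_def mult.commute)
  have \<phi>_sum: "\<phi> (\<Sum>i\<in>F. g i) = (\<Sum>i\<in>F. \<phi> (g i))" for g
    using Q.representation_sum[OF B(1), of F g] B(3) by (simp add: \<phi>_def)
  have \<phi>_zero: "\<phi> 0 = 0"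
    by (simp add: \<phi>_def Q.representation_zero)
  have \<phi>_rel: "(\<Sum>i\<in>F. \<phi> (c i) * of_nat (v i j)) = 0" if "j \<in> J" for j
    using rel[OF that] \<phi>_zero by (simp flip: \<phi>_scale \<phi>_sum)
  have "(\<Sum>i\<in>F. real_of_rat (\<phi> (c i)) * real (v i j)) = 0" if "j \<in> J" for j
  proof -
    have "real_of_rat (\<Sum>i\<in>F. \<phi> (c i) * of_nat (v i j)) = 0"
      using \<phi>_rel[OF that] by simp
    then show ?thesis
      by (simp add: of_rat_sum of_rat_mult)
  qed
  then have "real_of_rat (\<phi> (c i)) = 0"
    using indep[of "\<lambda>i. real_of_rat (\<phi> (c i))"] i by simp
  moreover have "\<phi> (c i) = 1"
    by (simp add: \<phi>_def Q.representation_basis[OF B(1,2)])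
  ultimately show False by simp
qed


section \<open>Permutation operators on tensor powers\<close>

text \<open>
  The orbits of the permutations of \<open>A\<close> on the functions \<open>A \<rightarrow> Q\<close> are given by the multisets of values.
\<close>

lemma card_contents_le:
  assumes "finite A" "finite Q"
  shows "card ((\<lambda>P. image_mset P (mset_set A)) ` (A \<rightarrow>\<^sub>E Q)) \<le> (card A + 1) ^ card Q"
    and "finite ((\<lambda>P. image_mset P (mset_set A)) ` (A \<rightarrow>\<^sub>E Q))"
proof -
  let ?M = "(\<lambda>P. image_mset P (mset_set A)) ` (A \<rightarrow>\<^sub>E Q)"
  show fin: "finite ?M"
    using assms by (intro finite_imageI finite_PiE) auto
  define h where "h M = (\<lambda>x\<in>Q. count M x)" for M :: "'b multiset"
  have M: "set_mset M \<subseteq> Q" "size M = card A" if "M \<in> ?M" for M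
    using that assms by (auto simp: PiE_iff)
  have "inj_on h ?M"
  proof (rule inj_onI)
    fix M N assume *: "M \<in> ?M" "N \<in> ?M" "h M = h N"
    show "M = N"
    proof (rule multiset_eqI)
      fix x show "count M x = count N x"
      proof (cases "x \<in> Q")
        case True
        then show ?thesis
          using fun_cong[OF *(3), of x] by (simp add: h_def)
      next
        case False
        then have "x \<notin># M" "x \<notin># N"
          using M(1) *(1,2) by blast+
        then show ?thesis
          by (simp add: not_in_iff)
      qed
    qed
  qed
  moreover have "h ` ?M \<subseteq> Q \<rightarrow>\<^sub>E {..card A}"
  proof (rule image_subsetI)
    fix M assume "M \<in> ?M"
    then have "count M x \<le> card A" for x
      using M(2) count_le_size by metis
    then show "h M \<in> Q \<rightarrow>\<^sub>E {..card A}"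
      by (auto simp: h_def)
  qed
  ultimately have "card ?M \<le> card (Q \<rightarrow>\<^sub>E {..card A})"
    by (intro card_inj_on_le) (use assms in \<open>auto intro: finite_PiE\<close>)
  then show "card ?M \<le> (card A + 1) ^ card Q"
    using assms by (simp add: card_PiE)
qed

text \<open>
  Each orbit contributes at most \<open>|A|!\<close> pairs of a permutation and a function fixed by it: writing every
  function \<open>P\<close> of the orbit as \<open>rep \<circ> g P\<close> for a chosen representative, the pair can be recovered from the
  permutation \<open>g P \<circ> \<rho>\<close>, because \<open>rep \<circ> g P \<circ> \<rho> = P \<circ> \<rho> = P\<close>.
\<close>

lemma sum_card_fixed_functions_le:
  fixes A :: "'a set" and Q :: "'b set"
  assumes A: "finite A" and Q: "finite Q"
  shows "(\<Sum>\<rho> | \<rho> permutes A. card {P \<in> A \<rightarrow>\<^sub>E Q. \<forall>k\<in>A. P (\<rho> k) = P k}) \<le>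
    fact (card A) * (card A + 1) ^ card Q"
proof -
  let ?X = "A \<rightarrow>\<^sub>E Q" and ?S = "{\<rho>. \<rho> permutes A}"
  let ?content = "\<lambda>P. image_mset P (mset_set A)"
  let ?E = "SIGMA \<rho>:?S. {P \<in> ?X. \<forall>k\<in>A. P (\<rho> k) = P k}"
  have finX: "finite ?X" and finS: "finite ?S"
    using A Q by (auto intro: finite_PiE finite_permutations)
  define rep where "rep M = (SOME P. P \<in> ?X \<and> ?content P = M)" for M
  have rep: "?content (rep (?content P)) = ?content P" if "P \<in> ?X" for P
    unfolding rep_def using that by (rule_tac someI2[of _ P]) auto
  have "\<exists>g. g permutes A \<and> (\<forall>k\<in>A. P k = rep (?content P) (g k))" if "P \<in> ?X" for P
    using image_mset_eq_implies_permutes[OF A rep[OF that, symmetric]] by blast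
  then obtain g where g: "\<And>P. P \<in> ?X \<Longrightarrow> g P permutes A"
    "\<And>P k. P \<in> ?X \<Longrightarrow> k \<in> A \<Longrightarrow> P k = rep (?content P) (g P k)"
    by metis
  define h :: "('a \<Rightarrow> 'a) \<times> ('a \<Rightarrow> 'b) \<Rightarrow> 'b multiset \<times> ('a \<Rightarrow> 'a)"
    where "h = (\<lambda>(\<rho>, P). (?content P, g P \<circ> \<rho>))"
  have "inj_on h ?E"
  proof (rule inj_onI, clarify)
    fix \<rho> P \<rho>' P'
    assume *: "\<rho> permutes A" "P \<in> ?X" "\<forall>k\<in>A. P (\<rho> k) = P k"
      "\<rho>' permutes A" "P' \<in> ?X" "\<forall>k\<in>A. P' (\<rho>' k) = P' k" "h (\<rho>, P) = h (\<rho>', P')"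
    then have eq: "?content P = ?content P'" "g P \<circ> \<rho> = g P' \<circ> \<rho>'"
      by (simp_all add: h_def)
    have "P k = rep (?content P) ((g P \<circ> \<rho>) k)" if "k \<in> A" for k
      using * that g(2)[of P "\<rho> k"] permutes_in_image[of \<rho> A k] by simp
    moreover have "P' k = rep (?content P') ((g P' \<circ> \<rho>') k)" if "k \<in> A" for k
      using * that g(2)[of P' "\<rho>' k"] permutes_in_image[of \<rho>' A k] by simp
    ultimately have "P k = P' k" if "k \<in> A" for k
      using that eq by metis
    then have "P = P'"
      by (rule PiE_ext[OF *(2,5)])
    moreover have "\<rho> = \<rho>'"
    proof
      fix k
      have "g P (\<rho> k) = g P (\<rho>' k)"
        using fun_cong[OF eq(2), of k] \<open>P = P'\<close> by simp
      then show "\<rho> k = \<rho>' k"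
        using permutes_inj[OF g(1)[OF *(2)]] by (simp add: inj_eq)
    qed
    ultimately show "\<rho> = \<rho>' \<and> P = P'" by simp
  qed
  moreover have "h ` ?E \<subseteq> ?content ` ?X \<times> ?S"
    using g(1) by (auto simp: h_def intro: permutes_compose)
  ultimately have "card ?E \<le> card (?content ` ?X \<times> ?S)"
    using card_contents_le(2)[OF A Q] finS by (intro card_inj_on_le) auto
  also have "\<dots> = card (?content ` ?X) * fact (card A)"
    using A by (simp add: card_cartesian_product card_permutations)
  also have "\<dots> \<le> (card A + 1) ^ card Q * fact (card A)"
    using card_contents_le(1)[OF A Q] by (intro mult_right_mono) auto
  finally show ?thesis
    using finX finS by (simp add: card_SigmaI mult.commute)
qed

lemma card_fixed_functions_squared:
  assumes A: "finite A" and D: "finite D" and \<rho>: "\<rho> permutes A"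
  shows "(card {p \<in> A \<rightarrow>\<^sub>E D. \<forall>k\<in>A. p (\<rho> k) = p k})\<^sup>2 \<le>
    card {P \<in> A \<rightarrow>\<^sub>E D \<times> D. \<forall>k\<in>A. P (\<rho> k) = P k}"
proof -
  let ?F = "{p \<in> A \<rightarrow>\<^sub>E D. \<forall>k\<in>A. p (\<rho> k) = p k}"
  let ?h = "\<lambda>(p, q). \<lambda>k\<in>A. (p k, q k)"
  have "inj_on ?h (?F \<times> ?F)"
  proof (rule inj_onI, clarify)
    fix p q p' q'
    assume *: "p \<in> A \<rightarrow>\<^sub>E D" "q \<in> A \<rightarrow>\<^sub>E D" "p' \<in> A \<rightarrow>\<^sub>E D" "q' \<in> A \<rightarrow>\<^sub>E D"
      and eq: "(\<lambda>k\<in>A. (p k, q k)) = (\<lambda>k\<in>A. (p' k, q' k))"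
    have "p k = p' k \<and> q k = q' k" if "k \<in> A" for k
      using fun_cong[OF eq, of k] that by simp
    then show "p = p' \<and> q = q'"
      using PiE_ext[OF *(1,3)] PiE_ext[OF *(2,4)] by blast
  qed
  moreover have "?h ` (?F \<times> ?F) \<subseteq> {P \<in> A \<rightarrow>\<^sub>E D \<times> D. \<forall>k\<in>A. P (\<rho> k) = P k}"
    using permutes_in_image[OF \<rho>] by (auto simp: PiE_iff)
  ultimately have "card (?F \<times> ?F) \<le> card {P \<in> A \<rightarrow>\<^sub>E D \<times> D. \<forall>k\<in>A. P (\<rho> k) = P k}"
    using finite_PiE[OF A, of "\<lambda>_. D \<times> D"] D by (intro card_inj_on_le) simp_all
  then show ?thesis
    by (simp add: card_cartesian_product power2_eq_square)
qed

text \<open>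
  The matrix, in the basis of pure tensors \<open>p\<close>, of the operator that permutes the factors of the tensor power
  indexed by \<open>A\<close>. The entry at \<open>(p, q)\<close> takes the pair as a single argument because the matrix is
  treated as a vector.
\<close>

definition permutation_matrix :: "'a set \<Rightarrow> ('a \<Rightarrow> 'a) \<Rightarrow> ('a \<Rightarrow> 'd) \<times> ('a \<Rightarrow> 'd) \<Rightarrow> nat" where
  "permutation_matrix A \<zeta> = (\<lambda>(p, q). if \<forall>k\<in>A. q k = p (\<zeta> k) then 1 else 0)"

text \<open>
  Both entries at \<open>(p, q)\<close> are \<open>1\<close> iff \<open>q = p \<circ> \<zeta> = p \<circ> \<xi>\<close>, so that \<open>q\<close> is determined by \<open>p\<close>.
\<close>

lemma dot_permutation_matrix:
  assumes A: "finite A" and D: "finite D" and \<zeta>: "\<zeta> permutes A" and \<xi>: "\<xi> permutes A"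
  shows "dot ((A \<rightarrow>\<^sub>E D) \<times> (A \<rightarrow>\<^sub>E D)) (\<lambda>j. real (permutation_matrix A \<zeta> j)) (\<lambda>j. real (permutation_matrix A \<xi> j)) =
    real (card {p \<in> A \<rightarrow>\<^sub>E D. \<forall>k\<in>A. p ((\<zeta> \<circ> inv \<xi>) k) = p k})"
proof -
  let ?X = "A \<rightarrow>\<^sub>E D"
  let ?E = "{(p, q) \<in> ?X \<times> ?X. (\<forall>k\<in>A. q k = p (\<zeta> k)) \<and> (\<forall>k\<in>A. q k = p (\<xi> k))}"
  have finX: "finite ?X"
    using A D by (auto intro: finite_PiE)
  have "dot (?X \<times> ?X) (\<lambda>j. real (permutation_matrix A \<zeta> j)) (\<lambda>j. real (permutation_matrix A \<xi> j)) =
      (\<Sum>j\<in>?X \<times> ?X. if j \<in> ?E then 1 else 0)"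
    unfolding dot_def by (intro sum.cong refl) (auto simp: permutation_matrix_def split: if_splits)
  also have "\<dots> = real (card ?E)"
  proof -
    have "(?X \<times> ?X) \<inter> ?E = ?E" by blast
    then show ?thesis
      using sum.inter_restrict[of "?X \<times> ?X" "\<lambda>_. 1 :: real" ?E] finX by simp
  qed
  also have "card ?E = card {p \<in> ?X. \<forall>k\<in>A. p ((\<zeta> \<circ> inv \<xi>) k) = p k}"
  proof (rule bij_betw_same_card)
    have fixed: "(\<forall>k\<in>A. p ((\<zeta> \<circ> inv \<xi>) k) = p k) \<longleftrightarrow> (\<forall>k\<in>A. p (\<zeta> k) = p (\<xi> k))" for p :: "'a \<Rightarrow> 'b"
    proof
      assume *: "\<forall>k\<in>A. p ((\<zeta> \<circ> inv \<xi>) k) = p k"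
      show "\<forall>k\<in>A. p (\<zeta> k) = p (\<xi> k)"
      proof
        fix k assume "k \<in> A"
        then have "p ((\<zeta> \<circ> inv \<xi>) (\<xi> k)) = p (\<xi> k)"
          using * permutes_in_image[OF \<xi>] by blast
        then show "p (\<zeta> k) = p (\<xi> k)"
          by (simp add: permutes_inverses(2)[OF \<xi>])
      qed
    next
      assume *: "\<forall>k\<in>A. p (\<zeta> k) = p (\<xi> k)"
      show "\<forall>k\<in>A. p ((\<zeta> \<circ> inv \<xi>) k) = p k"
      proof
        fix k assume "k \<in> A"
        then have "inv \<xi> k \<in> A"
          using permutes_in_image[OF permutes_inv[OF \<xi>]] by blast
        then show "p ((\<zeta> \<circ> inv \<xi>) k) = p k"
          using * by (simp add: permutes_inverses(1)[OF \<xi>])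
      qed
    qed
    show "bij_betw fst ?E {p \<in> ?X. \<forall>k\<in>A. p ((\<zeta> \<circ> inv \<xi>) k) = p k}"
      unfolding fixed
    proof (rule bij_betw_byWitness[where f' = "\<lambda>p. (p, \<lambda>k\<in>A. p (\<zeta> k))"])
      show "\<forall>e\<in>?E. (fst e, \<lambda>k\<in>A. fst e (\<zeta> k)) = e"
        by (auto simp: PiE_iff extensional_def fun_eq_iff)
      show "fst ` ?E \<subseteq> {p \<in> ?X. \<forall>k\<in>A. p (\<zeta> k) = p (\<xi> k)}"
        by auto
      show "(\<lambda>p. (p, \<lambda>k\<in>A. p (\<zeta> k))) ` {p \<in> ?X. \<forall>k\<in>A. p (\<zeta> k) = p (\<xi> k)} \<subseteq> ?E"
        using permutes_in_image[OF \<zeta>] by (auto simp: PiE_iff)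
    qed simp
  qed
  finally show ?thesis .
qed

text \<open>
  With \<open>M = |A|! (|A| + 1)\<^bsup>d d\<^esup>\<close> the bound for the sum of the squared entries in a row of the Gram
  matrix, \<open>rank_ge_trace_squared\<close> reads \<open>(|Z| d\<^bsup>|A|\<^esup>)\<^sup>2 \<le> |F| |Z| M\<close>.
\<close>

theorem many_independent_permutation_matrices:
  fixes D :: "'d set"
  assumes A: "finite A" and D: "finite D" and Z: "Z \<subseteq> {\<zeta>. \<zeta> permutes A}"
  obtains F where "F \<subseteq> Z"
    "card Z * card D ^ (2 * card A) \<le> card F * (fact (card A) * (card A + 1) ^ (card D)\<^sup>2)"
    "\<And>(c :: ('a \<Rightarrow> 'a) \<Rightarrow> 'k::field_char_0) \<zeta>.
      (\<And>p q. p \<in> A \<rightarrow>\<^sub>E D \<Longrightarrow> q \<in> A \<rightarrow>\<^sub>E D \<Longrightarrow> (\<Sum>\<zeta>\<in>F. c \<zeta> * of_nat (permutation_matrix A \<zeta> (p, q))) = 0) \<Longrightarrow>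
      \<zeta> \<in> F \<Longrightarrow> c \<zeta> = 0"
proof -
  let ?J = "(A \<rightarrow>\<^sub>E D) \<times> (A \<rightarrow>\<^sub>E D)" and ?S = "{\<rho>. \<rho> permutes A}"
  let ?v = "\<lambda>\<zeta> j. real (permutation_matrix A \<zeta> j)"
  let ?fix = "\<lambda>\<rho>. card {p \<in> A \<rightarrow>\<^sub>E D. \<forall>k\<in>A. p (\<rho> k) = p k}"
  let ?M = "fact (card A) * (card A + 1) ^ (card D)\<^sup>2 :: nat"
  have finS: "finite ?S"
    using A by (rule finite_permutations)
  have finZ: "finite Z"
    using Z finS by (rule finite_subset)
  have finJ: "finite ?J"
    using A D by (auto intro: finite_PiE)
  obtain F where F: "F \<subseteq> Z"
    and indep: "\<And>c. (\<forall>j\<in>?J. (\<Sum>i\<in>F. c i * ?v i j) = 0) \<Longrightarrow> \<forall>i\<in>F. c i = 0"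
    and rank: "(\<Sum>i\<in>Z. dot ?J (?v i) (?v i))\<^sup>2 \<le> real (card F) * (\<Sum>i\<in>Z. \<Sum>k\<in>Z. (dot ?J (?v i) (?v k))\<^sup>2)"
    using rank_ge_trace_squared[OF finZ finJ, of ?v] by blast
  have dot: "dot ?J (?v \<zeta>) (?v \<xi>) = real (?fix (\<zeta> \<circ> inv \<xi>))" if "\<zeta> \<in> Z" "\<xi> \<in> Z" for \<zeta> \<xi>
    using that Z by (intro dot_permutation_matrix A D) auto
  have "dot ?J (?v \<zeta>) (?v \<zeta>) = real (card D ^ card A)" if "\<zeta> \<in> Z" for \<zeta>
  proof -
    have "\<zeta> permutes A" using that Z by auto
    then show ?thesis
      using dot[OF that that] A by (simp add: permutes_inverses(1) card_PiE)
  qed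
  then have trace: "(\<Sum>i\<in>Z. dot ?J (?v i) (?v i)) = real (card Z * card D ^ card A)"
    by simp
  have "(\<Sum>\<xi>\<in>Z. (dot ?J (?v \<zeta>) (?v \<xi>))\<^sup>2) \<le> real ?M" if \<zeta>: "\<zeta> \<in> Z" for \<zeta>
  proof -
    have "inj_on (\<lambda>\<xi>. \<zeta> \<circ> inv \<xi>) Z"
    proof (rule inj_onI)
      fix \<xi> \<xi>' assume *: "\<xi> \<in> Z" "\<xi>' \<in> Z" "\<zeta> \<circ> inv \<xi> = \<zeta> \<circ> inv \<xi>'"
      have perm: "\<zeta> permutes A" "\<xi> permutes A" "\<xi>' permutes A"
        using \<zeta> * Z by auto
      have "inv \<xi> = inv \<xi>'"
        using *(3) permutes_inj[OF perm(1)] by (simp add: inj_eq fun_eq_iff)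
      then show "\<xi> = \<xi>'"
        by (metis perm(2,3) permutes_inv_inv)
    qed
    moreover have "(\<lambda>\<xi>. \<zeta> \<circ> inv \<xi>) ` Z \<subseteq> ?S"
      using \<zeta> Z by (auto intro!: permutes_compose permutes_inv)
    ultimately have "(\<Sum>\<xi>\<in>Z. (?fix (\<zeta> \<circ> inv \<xi>))\<^sup>2) \<le> (\<Sum>\<rho>\<in>?S. (?fix \<rho>)\<^sup>2)"
      using sum_mono2[OF finS, of "(\<lambda>\<xi>. \<zeta> \<circ> inv \<xi>) ` Z" "\<lambda>\<rho>. (?fix \<rho>)\<^sup>2"] by (simp add: sum.reindex)
    also have "\<dots> \<le> (\<Sum>\<rho>\<in>?S. card {P \<in> A \<rightarrow>\<^sub>E D \<times> D. \<forall>k\<in>A. P (\<rho> k) = P k})"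
      using A D by (intro sum_mono card_fixed_functions_squared) auto
    also have "\<dots> \<le> ?M"
      using sum_card_fixed_functions_le[OF A, of "D \<times> D"] D
      by (simp add: card_cartesian_product power2_eq_square)
    finally have "real (\<Sum>\<xi>\<in>Z. (?fix (\<zeta> \<circ> inv \<xi>))\<^sup>2) \<le> real ?M"
      by (rule of_nat_mono)
    then show ?thesis
      using \<zeta> by (simp add: dot)
  qed
  then have "(\<Sum>i\<in>Z. \<Sum>k\<in>Z. (dot ?J (?v i) (?v k))\<^sup>2) \<le> real (card Z * ?M)"
    using sum_bounded_above[of Z "\<lambda>i. \<Sum>k\<in>Z. (dot ?J (?v i) (?v k))\<^sup>2" "real ?M"] by simp
  then have "(real (card Z * card D ^ card A))\<^sup>2 \<le> real (card F) * real (card Z * ?M)"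
    using rank unfolding trace by (meson mult_left_mono of_nat_0_le_iff order_trans)
  then have "(card Z * card D ^ card A)\<^sup>2 \<le> card F * (card Z * ?M)"
    unfolding of_nat_mult[symmetric] of_nat_power[symmetric] of_nat_le_iff .
  then have "card Z * (card Z * card D ^ (2 * card A)) \<le> card Z * (card F * ?M)"
    by (simp add: power2_eq_square power_mult_distrib mult_ac flip: power_add mult_2)
  then have "card Z * card D ^ (2 * card A) \<le> card F * ?M"
    by (cases "card Z = 0") auto
  moreover have "c \<zeta> = 0"
    if "\<And>p q. p \<in> A \<rightarrow>\<^sub>E D \<Longrightarrow> q \<in> A \<rightarrow>\<^sub>E D \<Longrightarrow> (\<Sum>\<zeta>\<in>F. c \<zeta> * of_nat (permutation_matrix A \<zeta> (p, q))) = 0"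
      "\<zeta> \<in> F" for c :: "('a \<Rightarrow> 'a) \<Rightarrow> 'k" and \<zeta>
  proof (rule natural_vectors_independent_transfer[where c = c and F = F and v = "permutation_matrix A"])
    show "\<forall>i\<in>F. c i = 0" if "\<forall>j\<in>?J. (\<Sum>i\<in>F. c i * ?v i j) = 0" for c :: "('a \<Rightarrow> 'a) \<Rightarrow> real"
      using that by (rule indep)
  qed (use that in auto)
  ultimately show ?thesis
    using that[OF F] by blast
qed


section \<open>Codimensions of algebras with a large irreducible subspace\<close>

definition cyclic_shift :: "nat \<Rightarrow> nat \<Rightarrow> nat" where
  "cyclic_shift n k = (if k < n then Suc k else if k = n then 0 else k)"

text \<open>
  The cycle \<open>\<sigma> 0 \<mapsto> \<sigma> 1 \<mapsto> \<dots> \<mapsto> \<sigma> (n - 1) \<mapsto> n \<mapsto> \<sigma> 0\<close> when \<open>\<sigma>\<close> permutes \<open>{..<n}\<close>. The extra point \<open>n\<close>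
  stands for the matrix that closes the monomial of \<open>\<sigma>\<close> under the trace.
\<close>

definition closing_cycle :: "nat \<Rightarrow> (nat \<Rightarrow> nat) \<Rightarrow> nat \<Rightarrow> nat" where
  "closing_cycle n \<sigma> = \<sigma> \<circ> cyclic_shift n \<circ> inv \<sigma>"

lemma cyclic_shift_permutes: "cyclic_shift n permutes {..n}"
proof (rule bij_imp_permutes)
  have "inj_on (cyclic_shift n) {..n}"
    by (auto simp: inj_on_def cyclic_shift_def split: if_splits)
  moreover have "cyclic_shift n ` {..n} \<subseteq> {..n}"
    by (auto simp: cyclic_shift_def)
  ultimately show "bij_betw (cyclic_shift n) {..n} {..n}"
    by (simp add: bij_betw_def endo_inj_surj)
qed (simp add: cyclic_shift_def)

lemma permutes_atMost_of_lessThan: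
  fixes n :: nat
  shows "\<sigma> permutes {..<n} \<Longrightarrow> \<sigma> permutes {..n}"
  by (rule permutes_subset) auto

lemma closing_cycle_permutes:
  assumes "\<sigma> permutes {..<n}"
  shows "closing_cycle n \<sigma> permutes {..n}"
  unfolding closing_cycle_def
  by (intro permutes_compose permutes_inv permutes_atMost_of_lessThan[OF assms] cyclic_shift_permutes)

lemma closing_cycle_apply: "\<sigma> permutes {..<n} \<Longrightarrow> closing_cycle n \<sigma> (\<sigma> k) = \<sigma> (cyclic_shift n k)"
  by (simp add: closing_cycle_def permutes_inverses(2))

lemma inj_on_closing_cycle: "inj_on (closing_cycle n) {\<sigma>. \<sigma> permutes {..<n}}"
proof (rule inj_onI, clarify)
  fix \<sigma> \<tau> assume \<sigma>: "\<sigma> permutes {..<n}" and \<tau>: "\<tau> permutes {..<n}"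
    and eq: "closing_cycle n \<sigma> = closing_cycle n \<tau>"
  have outside: "\<sigma> k = k" "\<tau> k = k" if "k \<ge> n" for k
    using \<sigma> \<tau> that by (simp_all add: permutes_def)
  have "\<sigma> k = \<tau> k" if "k < n" for k
    using that
  proof (induction k)
    case 0
    have "\<sigma> 0 = closing_cycle n \<sigma> (\<sigma> n)"
      by (simp add: closing_cycle_apply[OF \<sigma>] cyclic_shift_def)
    also have "\<dots> = closing_cycle n \<tau> (\<tau> n)"
      by (simp add: eq outside)
    also have "\<dots> = \<tau> 0"
      by (simp add: closing_cycle_apply[OF \<tau>] cyclic_shift_def)
    finally show ?case .
  next
    case (Suc k)
    have "\<sigma> (Suc k) = closing_cycle n \<sigma> (\<sigma> k)"
      using Suc.prems by (simp add: closing_cycle_apply[OF \<sigma>] cyclic_shift_def)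
    also have "\<dots> = closing_cycle n \<tau> (\<tau> k)"
      using Suc by (simp add: eq)
    also have "\<dots> = \<tau> (Suc k)"
      using Suc.prems by (simp add: closing_cycle_apply[OF \<tau>] cyclic_shift_def)
    finally show ?case .
  qed
  then show "\<sigma> = \<tau>"
    using outside by (metis ext leI)
qed

lemma permutation_matrix_closing_cycle:
  assumes \<sigma>: "\<sigma> permutes {..<n}"
  shows "permutation_matrix {..n} (closing_cycle n \<sigma>) (p, q) =
    (if (\<forall>k<n. q (\<sigma> k) = p (\<sigma> (Suc k))) \<and> p (\<sigma> 0) = q n then 1 else 0)"
proof -
  have "(\<forall>k\<in>{..n}. q k = p (closing_cycle n \<sigma> k)) \<longleftrightarrow>
      (\<forall>k\<in>\<sigma> ` {..n}. q k = p (closing_cycle n \<sigma> k))"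
    using permutes_image[OF permutes_atMost_of_lessThan[OF \<sigma>]] by simp
  also have "\<dots> \<longleftrightarrow> (\<forall>k\<le>n. q (\<sigma> k) = p (\<sigma> (cyclic_shift n k)))"
    by (auto simp: closing_cycle_apply[OF \<sigma>])
  also have "\<dots> \<longleftrightarrow> (\<forall>k<n. q (\<sigma> k) = p (\<sigma> (Suc k))) \<and> p (\<sigma> 0) = q n"
  proof -
    have "\<sigma> n = n"
      using \<sigma> by (simp add: permutes_def)
    then show ?thesis
      by (force simp: cyclic_shift_def le_less)
  qed
  finally show ?thesis
    by (simp add: permutation_matrix_def)
qed

text \<open>
  The factor \<open>\<rho> k\<close> acts as the matrix unit that sends \<open>q k\<close> to \<open>p k\<close>; a product of such units is nonzero
  on a basis vector iff the indices of neighbouring factors match.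
\<close>

lemma matrix_unit_word:
  fixes \<rho> p q :: "nat \<Rightarrow> 'a::ring_1"
  assumes \<rho>: "\<And>k. k < n \<Longrightarrow> \<rho> (\<sigma> k) * p (\<sigma> (Suc k)) = (if q (\<sigma> k) = p (\<sigma> (Suc k)) then p (\<sigma> k) else 0)"
    and "j \<le> n"
  shows "prod_list (map \<rho> (map \<sigma> [j..<n])) * p (\<sigma> n) =
    (if \<forall>k\<in>{j..<n}. q (\<sigma> k) = p (\<sigma> (Suc k)) then p (\<sigma> j) else 0)"
  using \<open>j \<le> n\<close>
proof (induction j rule: inc_induct)
  case (step j)
  have "prod_list (map \<rho> (map \<sigma> [j..<n])) * p (\<sigma> n) =
      \<rho> (\<sigma> j) * (prod_list (map \<rho> (map \<sigma> [Suc j..<n])) * p (\<sigma> n))"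
    using step.hyps by (simp add: upt_conv_Cons mult.assoc)
  also have "\<dots> = (if \<forall>k\<in>{j..<n}. q (\<sigma> k) = p (\<sigma> (Suc k)) then p (\<sigma> j) else 0)"
  proof -
    have "{j..<n} = insert j {Suc j..<n}"
      using step.hyps by auto
    then show ?thesis
      unfolding step.IH using \<rho>[OF step.hyps(2)] by simp
  qed
  finally show ?case .
qed simp

locale characteristic_zero_algebra = closed_finite_dimensional_algebra scale Basis
  for scale :: "'k::{alg_closed_field, field_char_0} \<Rightarrow> 'a::ring_1 \<Rightarrow> 'a" and Basis
begin

text \<open>
  The monomial of \<open>\<sigma>\<close>, evaluated at matrix units on \<open>V\<close> and applied to the basis vector \<open>p n\<close>, has as its
  coordinate at \<open>q n\<close> the entry at \<open>(p, q)\<close> of the permutation matrix of \<open>closing_cycle n \<sigma>\<close>. Hence monomials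
  whose cycles have independent permutation matrices are independent modulo the identities.
\<close>

theorem codimension_ge:
  assumes V: "irreducible_subspace V"
  shows "dim V ^ (2 * Suc n) \<le> codimension n * (Suc n * (n + 2) ^ (dim V)\<^sup>2)"
proof -
  let ?P = "{\<sigma>. \<sigma> permutes {..<n}}"
  obtain C where C: "C \<subseteq> V" "independent C" "V \<subseteq> span C" "card C = dim V"
    using basis_exists by blast
  have finC: "finite C"
    using C(2) by (rule finiteI_independent)
  have finP: "finite ?P"
    by (simp add: finite_permutations)
  have "\<forall>b c. \<exists>r. b \<in> C \<longrightarrow> c \<in> C \<longrightarrow> r * c = b \<and> (\<forall>x\<in>C - {c}. r * x = 0)"
    using burnside_matrix_units[OF V C(1,2)] C(1) by blast
  then obtain e where e: "\<And>b c. b \<in> C \<Longrightarrow> c \<in> C \<Longrightarrow> e b c * c = b \<and> (\<forall>x\<in>C - {c}. e b c * x = 0)"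
    unfolding choice_iff by blast
  have e_apply: "e b c * x = (if c = x then b else 0)" if "b \<in> C" "c \<in> C" "x \<in> C" for b c x
    using e[OF that(1,2)] that(3) by auto
  obtain F where F: "F \<subseteq> closing_cycle n ` ?P"
    and card: "card (closing_cycle n ` ?P) * card C ^ (2 * card {..n}) \<le>
      card F * (fact (card {..n}) * (card {..n} + 1) ^ (card C)\<^sup>2)"
    and indep: "\<And>(c :: (nat \<Rightarrow> nat) \<Rightarrow> 'k) \<zeta>. (\<And>p q. p \<in> {..n} \<rightarrow>\<^sub>E C \<Longrightarrow> q \<in> {..n} \<rightarrow>\<^sub>E C \<Longrightarrow>
      (\<Sum>\<zeta>\<in>F. c \<zeta> * of_nat (permutation_matrix {..n} \<zeta> (p, q))) = 0) \<Longrightarrow> \<zeta> \<in> F \<Longrightarrow> c \<zeta> = 0"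
    by (rule many_independent_permutation_matrices[of "{..n}" C "closing_cycle n ` ?P"])
      (use finC closing_cycle_permutes in auto)
  define G where "G = {\<sigma> \<in> ?P. closing_cycle n \<sigma> \<in> F}"
  have G: "closing_cycle n ` G = F"
    using F by (auto simp: G_def)
  have inj: "inj_on (closing_cycle n) G"
    by (rule inj_on_subset[OF inj_on_closing_cycle]) (auto simp: G_def)
  have "card G \<le> codimension n"
    unfolding codimension_def
  proof (rule free_algebra.card_le_quotient_dim[where b = "\<lambda>\<sigma>. fa_monomial (map \<sigma> [0..<n])"
        and T = "{fa_monomial (map \<sigma> [0..<n]) | \<sigma>. \<sigma> permutes {..<n}}"])
    show "free_algebra.subspace (multilinear_space n \<inter> identities)"
      by (intro free_algebra.subspace_inter subspace_multilinear subspace_identities)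
    show "finite {fa_monomial (map \<sigma> [0..<n]) :: 'k free_algebra | \<sigma>. \<sigma> permutes {..<n}}"
      using finP by (simp add: setcompr_eq_image)
    show "finite G"
      using finP by (simp add: G_def)
    show "fa_monomial (map \<sigma> [0..<n]) \<in> multilinear_space n" if "\<sigma> \<in> G" for \<sigma>
      unfolding multilinear_space_def using that by (intro free_algebra.span_base) (auto simp: G_def)
    fix c assume "(\<Sum>\<sigma>\<in>G. fa_scale (c \<sigma>) (fa_monomial (map \<sigma> [0..<n]))) \<in> multilinear_space n \<inter> identities"
    then have identity: "(\<Sum>\<sigma>\<in>G. scale (c \<sigma>) (prod_list (map \<rho> (map \<sigma> [0..<n])))) = 0" for \<rho>
      by (simp add: identities_def evaluate_sum evaluate_scale evaluate_monomial)
    have rel: "(\<Sum>\<sigma>\<in>G. c \<sigma> * of_nat (permutation_matrix {..n} (closing_cycle n \<sigma>) (p, q))) = 0"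
      if p: "p \<in> {..n} \<rightarrow>\<^sub>E C" and q: "q \<in> {..n} \<rightarrow>\<^sub>E C" for p q
    proof -
      define \<rho> where "\<rho> k = e (p k) (q k)" for k
      define coef where "coef x = representation C x (q n)" for x
      have mem: "p k \<in> C" "q k \<in> C" if "k \<le> n" for k
        using p q that by auto
      have le: "\<sigma> k \<le> n" if "\<sigma> \<in> G" "k \<le> n" for \<sigma> k
        using that permutes_in_image[OF permutes_atMost_of_lessThan, of \<sigma> n k] by (auto simp: G_def)
      have word: "coef (prod_list (map \<rho> (map \<sigma> [0..<n])) * p n) =
          of_nat (permutation_matrix {..n} (closing_cycle n \<sigma>) (p, q))"
        and word_mem: "prod_list (map \<rho> (map \<sigma> [0..<n])) * p n \<in> span C" if \<sigma>: "\<sigma> \<in> G" for \<sigma>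
      proof -
        have perm: "\<sigma> permutes {..<n}" and "\<sigma> n = n"
          using \<sigma> by (auto simp: G_def permutes_def)
        have "prod_list (map \<rho> (map \<sigma> [0..<n])) * p (\<sigma> n) =
            (if \<forall>k\<in>{0..<n}. q (\<sigma> k) = p (\<sigma> (Suc k)) then p (\<sigma> 0) else 0)"
          by (rule matrix_unit_word) (simp_all add: \<rho>_def e_apply mem le[OF \<sigma>])
        then have eq: "prod_list (map \<rho> (map \<sigma> [0..<n])) * p n =
            (if \<forall>k<n. q (\<sigma> k) = p (\<sigma> (Suc k)) then p (\<sigma> 0) else 0)"
          using \<open>\<sigma> n = n\<close> by (simp add: Ball_def)
        have "p (\<sigma> 0) \<in> C"
          using mem le[OF \<sigma>] by simp
        then show "coef (prod_list (map \<rho> (map \<sigma> [0..<n])) * p n) =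
            of_nat (permutation_matrix {..n} (closing_cycle n \<sigma>) (p, q))"
          unfolding eq permutation_matrix_closing_cycle[OF perm]
          by (simp add: coef_def representation_basis[OF C(2)] representation_zero)
        show "prod_list (map \<rho> (map \<sigma> [0..<n])) * p n \<in> span C"
          unfolding eq using \<open>p (\<sigma> 0) \<in> C\<close> by (simp add: span_base span_zero)
      qed
      have "0 = coef ((\<Sum>\<sigma>\<in>G. scale (c \<sigma>) (prod_list (map \<rho> (map \<sigma> [0..<n])))) * p n)"
        unfolding identity by (simp add: coef_def representation_zero)
      also have "\<dots> = coef (\<Sum>\<sigma>\<in>G. scale (c \<sigma>) (prod_list (map \<rho> (map \<sigma> [0..<n])) * p n))"
        by (simp add: sum_distrib_right scale_mult_left)
      also have "\<dots> = (\<Sum>\<sigma>\<in>G. coef (scale (c \<sigma>) (prod_list (map \<rho> (map \<sigma> [0..<n])) * p n)))"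
        using representation_sum[OF C(2), of G] word_mem by (simp add: coef_def span_scale)
      also have "\<dots> = (\<Sum>\<sigma>\<in>G. c \<sigma> * coef (prod_list (map \<rho> (map \<sigma> [0..<n])) * p n))"
        using representation_scale[OF C(2)] word_mem by (intro sum.cong refl) (simp add: coef_def)
      also have "\<dots> = (\<Sum>\<sigma>\<in>G. c \<sigma> * of_nat (permutation_matrix {..n} (closing_cycle n \<sigma>) (p, q)))"
        by (intro sum.cong refl) (simp only: word)
      finally show ?thesis by simp
    qed
    define c' where "c' \<zeta> = c (the_inv_into G (closing_cycle n) \<zeta>)" for \<zeta>
    have c': "c' (closing_cycle n \<sigma>) = c \<sigma>" if "\<sigma> \<in> G" for \<sigma>
      using that by (simp add: c'_def the_inv_into_f_f[OF inj])
    have "(\<Sum>\<zeta>\<in>F. c' \<zeta> * of_nat (permutation_matrix {..n} \<zeta> (p, q))) = 0"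
      if "p \<in> {..n} \<rightarrow>\<^sub>E C" "q \<in> {..n} \<rightarrow>\<^sub>E C" for p q
      unfolding G[symmetric] sum.reindex[OF inj] using rel[OF that] by (simp add: c')
    then have "c' \<zeta> = 0" if "\<zeta> \<in> F" for \<zeta>
      using indep[of c'] that by blast
    then show "\<forall>\<sigma>\<in>G. c \<sigma> = 0"
      using G c' by (metis image_eqI)
  qed (auto simp: subspace_multilinear multilinear_space_def)
  then have "card F \<le> codimension n"
    using card_image[OF inj] G by simp
  have "fact n * dim V ^ (2 * Suc n) \<le> card F * (fact (Suc n) * (n + 2) ^ (dim V)\<^sup>2)"
    using card card_image[OF inj_on_closing_cycle, of n] C(4) card_permutations[of "{..<n}" n] by simp
  also have "\<dots> \<le> codimension n * (fact (Suc n) * (n + 2) ^ (dim V)\<^sup>2)"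
    using \<open>card F \<le> codimension n\<close> by (rule mult_right_mono) simp
  also have "\<dots> = fact n * (codimension n * (Suc n * (n + 2) ^ (dim V)\<^sup>2))"
    by (simp only: fact_Suc of_nat_id mult_ac)
  finally show ?thesis
    by simp
qed

end


section \<open>The exponent\<close>

text \<open>
  For \<open>n \<ge> 1\<close> the polynomial is at most \<open>(3 n)\<^bsup>D+1\<^esup>\<close>, and the \<open>n\<close>-th roots of \<open>3\<close> and of \<open>n\<close> tend to \<open>1\<close>.
\<close>

lemma root_tendsto_of_polynomial_bounds:
  fixes c :: "nat \<Rightarrow> nat"
  assumes upper: "\<And>n. c n \<le> m ^ n" and lower: "\<And>n. m ^ n \<le> c n * (Suc n * (n + 2) ^ D)"
  shows "(\<lambda>n. root n (real (c n))) \<longlonglongrightarrow> real m"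
proof (rule tendsto_sandwich)
  let ?g = "\<lambda>n. (root n 3 * root n (real n)) ^ Suc D"
  have "?g \<longlonglongrightarrow> (1 * 1) ^ Suc D"
    by (intro tendsto_power tendsto_mult LIMSEQ_root LIMSEQ_root_const) simp
  then have "(\<lambda>n. real m / ?g n) \<longlonglongrightarrow> real m / (1 * 1) ^ Suc D"
    by (intro tendsto_divide tendsto_const) auto
  then show "(\<lambda>n. real m / ?g n) \<longlonglongrightarrow> real m"
    by simp
  show "(\<lambda>n. real m) \<longlonglongrightarrow> real m" by simp
  show "\<forall>\<^sub>F n in sequentially. root n (real (c n)) \<le> real m"
    using eventually_gt_at_top[of 0]
  proof eventually_elim
    case (elim n)
    have "root n (real (c n)) \<le> root n (real m ^ n)"
      using upper[of n] elim by (simp flip: of_nat_power)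
    then show ?case
      using elim by (simp add: real_root_power_cancel)
  qed
  show "\<forall>\<^sub>F n in sequentially. real m / ?g n \<le> root n (real (c n))"
    using eventually_gt_at_top[of 0]
  proof eventually_elim
    case (elim n)
    have "Suc n * (n + 2) ^ D \<le> (3 * n) * (3 * n) ^ D"
      using elim by (intro mult_mono power_mono) auto
    then have "m ^ n \<le> c n * (3 * n) ^ Suc D"
      using lower[of n] by (metis mult_le_mono2 order_trans power_Suc)
    then have "real m ^ n \<le> real (c n) * (3 * real n) ^ Suc D"
      by (metis of_nat_le_iff of_nat_mult of_nat_numeral of_nat_power)
    then have "root n (real m ^ n) \<le> root n (real (c n) * (3 * real n) ^ Suc D)"
      using elim by (simp only: real_root_le_iff)
    then have "real m \<le> root n (real (c n)) * ?g n"
      using elim by (simp add: real_root_mult real_root_power real_root_power_cancel power_mult_distrib del: power_Suc)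
    moreover have "?g n > 0"
      using elim by simp
    ultimately show ?case
      by (simp add: pos_divide_le_eq)
  qed
qed

theorem corollary49:
  fixes scale :: "'k::{alg_closed_field, field_char_0} \<Rightarrow> 'a::ring_1 \<Rightarrow> 'a"
    and m :: nat and R :: "nat \<Rightarrow> 'a set" and \<theta> :: "nat \<Rightarrow> nat \<Rightarrow> 'k"
  assumes "regular_quantum_commutative_algebra scale m R \<theta>"
    and "unital_algebra.finite_dimensional scale"
    and "minimal_decomposition m \<theta>"
  shows "convergent (\<lambda>n. root n (real (unital_algebra.codimension scale n))) \<and>
         real m = unital_algebra.PI_exponent scale"
proof -
  interpret regular_quantum_commutative_algebra scale m R \<theta>
    by fact
  obtain T where T: "finite T" "span T = UNIV"
    using assms(2) unfolding finite_dimensional_def by blast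
  obtain B where B: "independent B" "span B = UNIV"
    using maximal_independent_subset[of UNIV] by (metis top.extremum_uniqueI)
  have "finite B"
    using independent_span_bound[OF T(1) B(1)] T(2) by simp
  interpret finite_dimensional_regular_algebra scale m R \<theta> B
    by unfold_locales (use B \<open>finite B\<close> in auto)
  interpret characteristic_zero_algebra scale B
    by unfold_locales
  obtain V where V: "irreducible_subspace V" "m \<le> (dim V)\<^sup>2"
    using large_irreducible_subspace[OF assms(3)] by blast
  have "{1..m} \<noteq> {}"
  proof
    assume "{1..m} = {}"
    then have "(1::'a) = 0"
      using homogeneous_decomposition[of 1] by (metis sum.empty)
    then show False by simp
  qed
  then have "m \<ge> 1" by simp
  have lower: "m ^ n \<le> codimension n * (Suc n * (n + 2) ^ (dim V)\<^sup>2)" for n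
  proof -
    have "m ^ n \<le> m ^ Suc n"
      using \<open>m \<ge> 1\<close> by (intro power_increasing) auto
    also have "\<dots> \<le> ((dim V)\<^sup>2) ^ Suc n"
      using V(2) by (rule power_mono) simp
    also have "\<dots> = dim V ^ (2 * Suc n)"
      by (simp only: power_mult)
    also have "\<dots> \<le> codimension n * (Suc n * (n + 2) ^ (dim V)\<^sup>2)"
      by (rule codimension_ge[OF V(1)])
    finally show ?thesis .
  qed
  have "(\<lambda>n. root n (real (codimension n))) \<longlonglongrightarrow> real m"
    by (rule root_tendsto_of_polynomial_bounds[OF codimension_le_power lower])
  then show ?thesis
    unfolding PI_exponent_def by (simp add: convergentI limI)
qed

end
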